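(* There is a polynomial-time algorithm that transforms a Colorful $2$-NU$k$C instance $\mathcal{I}=((X,d),(\omega_r,\omega_b,m_r,m_b),(k_1,k_2),(r_1,r_2))$ into an instance $\mathcal{I}''=((X,d),(\chi_r,\chi_b,m_r,m_b),(k_1,k_2),(r''_1,0))$ of Colorful $2$-NU$k$C with $r''_1=r_1+26r_2$, with the following properties: (a) if $\mathcal{I}$ has a feasible solution, then so does $\mathcal{I}''$; (b) given an $\alpha$-approximate solution to $\mathcal{I}''$, one can construct, in polynomial time, a $c\cdot\alpha$-approximate solution to $\mathcal{I}$, where $c>0$ is an absolute constant.
   Context: Let $(X,d)$ be a finite metric space. For $p\in X$, $r\ge0$, $B(p,r)=\{q\in X:d(p,q)\le r\}$; balls are centered at points of $X$. For $f$ on $X$ and $S\subseteq X$, $f(S)=\sum_{s\in S}f(s)$. An instance of Colorful $2$-NU$k$C is $((X,d),(\omega_r,\omega_b,m_r,m_b),(k_1,k_2),(r_1,r_2))$ with $r_1\ge r_2\ge0$, non-negative integers $k_1,k_2$, weight functions $\omega_r,\omega_b:X\to\mathbb{Z}_{\ge0}$ (red and blue weights) and integers $m_r,m_b$. A feasible solution is $(\mathcal{B}_1,\mathcal{B}_2)$ where $\mathcal{B}_i$ is a set of at most $k_i$ balls of radius $r_i$, such that the set $Y$ of points covered by $\mathcal{B}_1\cup\mathcal{B}_2$ satisfies $\omega_r(Y)\ge m_r$ and $\omega_b(Y)\ge m_b$. An $\alpha$-approximate solution is the same but with balls of $\mathcal{B}_i$ having radius $\alpha r_i$ (so with radius $0$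 at level $2$ of $\mathcal{I}''$ each such ball covers only its center).
   Formalization: In (b) the approximation factor α is taken to be at least 1 (for small α the claim fails); as inputs of the algorithm, distances and radii are rational numbers in binary. *)

theory Defs
  imports
    "HOL-Analysis.Analysis"
    "HOL-Library.Log_Nat"
    "HOL-Computational_Algebra.Polynomial"
begin

section \<open>Colorful 2-NUkC\<close>

record 'a cnukc =
  pts :: "'a set"
  metr :: "'a \<Rightarrow> 'a \<Rightarrow> real"
  red :: "'a \<Rightarrow> nat"
  blue :: "'a \<Rightarrow> nat"
  m_red :: int
  m_blue :: int
  k1 :: nat
  k2 :: nat
  rad1 :: real
  rad2 :: real

definition cnukc_instance :: "'a cnukc \<Rightarrow> bool" where
  "cnukc_instance I \<longleftrightarrow>
     finite (pts I) \<and> Metric_space (pts I) (metr I) \<and> rad1 I \<ge> rad2 I \<and> rad2 I \<ge> 0"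

text \<open>
  A set of at most \<open>k\<close> balls of a common radius is given by the set of its centers, one center
  per ball.  Hence a solution is a pair of sets of points; the radii are supplied separately.
\<close>

definition covered :: "'a cnukc \<Rightarrow> real \<Rightarrow> real \<Rightarrow> 'a set \<times> 'a set \<Rightarrow> 'a set" where
  "covered I \<rho>1 \<rho>2 S =
     (\<Union>p\<in>fst S. Metric_space.mcball (pts I) (metr I) p \<rho>1) \<union>
     (\<Union>p\<in>snd S. Metric_space.mcball (pts I) (metr I) p \<rho>2)"

definition solution_with_radii :: "'a cnukc \<Rightarrow> real \<Rightarrow> real \<Rightarrow> 'a set \<times> 'a set \<Rightarrow> bool" where
  "solution_with_radii I \<rho>1 \<rho>2 S \<longleftrightarrow>
     fst S \<subseteq> pts I \<and> card (fst S) \<le> k1 I \<and>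
     snd S \<subseteq> pts I \<and> card (snd S) \<le> k2 I \<and>
     int (\<Sum>p\<in>covered I \<rho>1 \<rho>2 S. red I p) \<ge> m_red I \<and>
     int (\<Sum>p\<in>covered I \<rho>1 \<rho>2 S. blue I p) \<ge> m_blue I"

definition feasible_solution :: "'a cnukc \<Rightarrow> 'a set \<times> 'a set \<Rightarrow> bool" where
  "feasible_solution I S \<longleftrightarrow> solution_with_radii I (rad1 I) (rad2 I) S"

definition approx_solution :: "real \<Rightarrow> 'a cnukc \<Rightarrow> 'a set \<times> 'a set \<Rightarrow> bool" where
  "approx_solution \<alpha> I S \<longleftrightarrow> solution_with_radii I (\<alpha> * rad1 I) (\<alpha> * rad2 I) S"


section \<open>Polynomial time\<close>

text \<open>
  The machine model is a structured random access machine over unbounded integers with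
  logarithmic cost, which is polynomially equivalent to Turing machines.  Memory consists of
  finitely many (per program) named, integer-indexed arrays.  Every evaluated subexpression is
  charged the bit length of its value; in particular arithmetic operations and memory accesses
  are charged for the bit lengths of their operands and addresses, so large numbers are not free.
\<close>

type_synonym mem = "string \<Rightarrow> int \<Rightarrow> int"

datatype aexp =
    Const int
  | Load string aexp
  | Add aexp aexp
  | Sub aexp aexp
  | Mul aexp aexp
  | Div aexp aexp

datatype bexp = Leq aexp aexp | Not bexp | And bexp bexp

datatype prog =
    Skip
  | Store string aexp aexp
  | Seq prog prog
  | If bexp prog prog
  | While bexp prog

fun aval :: "aexp \<Rightarrow> mem \<Rightarrow> int" where
  "aval (Const n) s = n"
| "aval (Load A e) s = s A (aval e s)"
| "aval (Add e f) s = aval e s + aval f s"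
| "aval (Sub e f) s = aval e s - aval f s"
| "aval (Mul e f) s = aval e s * aval f s"
| "aval (Div e f) s = aval e s div aval f s"

fun bval :: "bexp \<Rightarrow> mem \<Rightarrow> bool" where
  "bval (Leq e f) s \<longleftrightarrow> aval e s \<le> aval f s"
| "bval (Not b) s \<longleftrightarrow> \<not> bval b s"
| "bval (And b c) s \<longleftrightarrow> bval b s \<and> bval c s"

text \<open>One extra unit pays for the sign, so that no integer has length \<open>0\<close>.\<close>

definition bits :: "int \<Rightarrow> nat" where
  "bits n = nat (bitlen \<bar>n\<bar>) + 1"

fun acost :: "aexp \<Rightarrow> mem \<Rightarrow> nat" where
  "acost (Const n) s = bits n"
| "acost (Load A e) s = acost e s + bits (aval (Load A e) s)"
| "acost (Add e f) s = acost e s + acost f s + bits (aval (Add e f) s)"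
| "acost (Sub e f) s = acost e s + acost f s + bits (aval (Sub e f) s)"
| "acost (Mul e f) s = acost e s + acost f s + bits (aval (Mul e f) s)"
| "acost (Div e f) s = acost e s + acost f s + bits (aval (Div e f) s)"

fun bcost :: "bexp \<Rightarrow> mem \<Rightarrow> nat" where
  "bcost (Leq e f) s = acost e s + acost f s + 1"
| "bcost (Not b) s = bcost b s + 1"
| "bcost (And b c) s = bcost b s + bcost c s + 1"

text \<open>\<open>exec c s t s'\<close>: started in \<open>s\<close>, the program \<open>c\<close> halts in \<open>s'\<close> with total cost \<open>t\<close>.\<close>

inductive exec :: "prog \<Rightarrow> mem \<Rightarrow> nat \<Rightarrow> mem \<Rightarrow> bool" where
  Skip: "exec Skip s 1 s"
| Store: "exec (Store A e f) s (acost e s + acost f s + 1) (s(A := (s A)(aval e s := aval f s)))"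
| Seq: "exec c s t s' \<Longrightarrow> exec d s' u s'' \<Longrightarrow> exec (Seq c d) s (t + u) s''"
| If_True: "bval b s \<Longrightarrow> exec c s t s' \<Longrightarrow> exec (If b c d) s (bcost b s + t) s'"
| If_False: "\<not> bval b s \<Longrightarrow> exec d s t s' \<Longrightarrow> exec (If b c d) s (bcost b s + t) s'"
| While_False: "\<not> bval b s \<Longrightarrow> exec (While b c) s (bcost b s) s"
| While_True: "bval b s \<Longrightarrow> exec c s t s' \<Longrightarrow> exec (While b c) s' u s'' \<Longrightarrow>
    exec (While b c) s (bcost b s + t + u) s''"

text \<open>
  Inputs and outputs are lists of integers, stored in the arrays \<open>in\<close> and \<open>out\<close> with the length
  at index \<open>0\<close> and the entries from index \<open>1\<close> on; all other cells are initially \<open>0\<close>.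
\<close>

definition init_mem :: "int list \<Rightarrow> mem" where
  "init_mem xs = (\<lambda>A i.
     if A = ''in'' \<and> 0 \<le> i \<and> i \<le> int (length xs) then (int (length xs) # xs) ! nat i else 0)"

definition out_list :: "mem \<Rightarrow> int list" where
  "out_list s = map (\<lambda>i. s ''out'' (1 + int i)) [0..<nat (s ''out'' 0)]"

definition input_size :: "int list \<Rightarrow> nat" where
  "input_size xs = (\<Sum>x\<leftarrow>xs. bits x)"

text \<open>
  \<open>f x\<close> is the encoded result on the argument \<open>x \<in> D\<close>; nothing is required of the program on inputs
  outside \<open>D\<close>.  The length of the output is charged as well, since its entries equal to \<open>0\<close> need not
  have been written.
\<close>

definition polytime_on :: "'a set \<Rightarrow> ('a \<Rightarrow> int list) \<Rightarrow> ('a \<Rightarrow> int list) \<Rightarrow> bool" where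
  "polytime_on D enc f \<longleftrightarrow>
     (\<exists>(c :: prog) (P :: nat poly). \<forall>x\<in>D. \<exists>t s.
        exec c (init_mem (enc x)) t s \<and> out_list s = f x \<and>
        t + length (f x) \<le> poly P (input_size (enc x)))"


section \<open>Encoding of instances and solutions\<close>

text \<open>
  As an input to an algorithm, a finite metric space consists of the points \<open>0, \<dots>, n - 1\<close> and a
  matrix of rational distances; the radii are rational as well.  All numbers are in binary.
\<close>

definition encodable :: "nat cnukc \<Rightarrow> bool" where
  "encodable I \<longleftrightarrow>
     pts I = {..<card (pts I)} \<and> (\<forall>p\<in>pts I. \<forall>q\<in>pts I. metr I p q \<in> \<rat>) \<and>
     rad1 I \<in> \<rat> \<and> rad2 I \<in> \<rat>"

text \<open>Numerator and positive denominator in lowest terms; meaningful for rational arguments.\<close>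

definition enc_rat :: "real \<Rightarrow> int list" where
  "enc_rat x = (let (a, b) = quotient_of (THE q. of_rat q = x) in [a, b])"

definition enc_instance :: "nat cnukc \<Rightarrow> int list" where
  "enc_instance I = (let n = card (pts I) in
     [int n]
     @ concat (map (\<lambda>p. concat (map (\<lambda>q. enc_rat (metr I p q)) [0..<n])) [0..<n])
     @ map (\<lambda>p. int (red I p)) [0..<n]
     @ map (\<lambda>p. int (blue I p)) [0..<n]
     @ [m_red I, m_blue I, int (k1 I), int (k2 I)]
     @ enc_rat (rad1 I) @ enc_rat (rad2 I))"

text \<open>Sets of centers are encoded by their characteristic vectors of length \<open>n\<close>.\<close>

definition enc_solution :: "nat \<Rightarrow> nat set \<times> nat set \<Rightarrow> int list" where
  "enc_solution n S = map (\<lambda>p. of_bool (p \<in> fst S)) [0..<n] @ map (\<lambda>p. of_bool (p \<in> snd S)) [0..<n]"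

end

theory Submission
  imports Defs
begin

text \<open>
  Cluster the points greedily, once per colour: repeatedly take a centre whose ball of radius \<open>r2\<close>
  has the largest uncovered weight and let its cluster be the uncovered part of the ball of radius
  \<open>3 * r2\<close>.  For each colour the small balls of a solution can then be matched injectively with
  nearby clusters of at least their total weight, avoiding the clusters already reached by the
  enlarged big balls.  A ball thus asks for a red cluster and a blue cluster at distance at most
  \<open>8 * r2\<close>.  Every red cluster is shipped to its \<^emph>\<open>heaviest\<close> blue cluster within that distance;
  \<open>\<chi>r\<close> and \<open>\<chi>b\<close> record, at the centre of a blue cluster, the red weight received and the blue weight.
  Taking the favourite of each requested red cluster serves the red demand and never decreases the
  blue weight of a single request.  Several requests may share a favourite, but each collision
  frees a ball, which can be spent on one of the requested blue clusters; an exchange argument shows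
  that this suffices.  Conversely every point is counted at a centre at distance at most \<open>11 * r2\<close>, so
  the centres of an approximate solution can be kept unchanged.
\<close>

section \<open>Greedy clusterings\<close>

text \<open>The target instance is computed without knowing a solution, so the place where a red
  cluster is counted must be fixed in advance, although a small ball may pair it with any blue
  cluster in reach. Sending it to the heaviest candidate guards against all partners at once. The
  price is collisions, and these never cost red weight: everything sent to a shared favourite is
  counted there together.

  Constants, in multiples of \<open>r2\<close>: if two unit balls meet, one lies in the ball of
  radius 1 + 1 + 1 = 3 around the other's centre; a ball and a cluster matched to it share a point,
  so their centres are 3 + 1 = 4 apart; the red and the blue cluster of one ball are then 4 + 4 = 8
  apart; a point is 3 + 8 = 11 from where its red weight is counted, which is within 26. The way
  back costs 1 + 26 + 26 = 53.

  Ties may be broken arbitrarily, so the transformation is specified as a relation,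
  \<open>reduction\<close>, of which the program computes one instance. For the running time it is
  enough to count elementary steps, because all memory cells stay below a bound whose bit length is
  linear in the input size.\<close>

text \<open>Requests are handled in order of decreasing \<open>w (b q)\<close>. One whose
  \<open>a q\<close> is new buys it, and \<open>w (a q)\<close> pays for \<open>w (b q)\<close>. Any
  other request has a ball to spare; being the lightest so far, it is paid for by any requested
  \<open>b y\<close> that is missing from \<open>K\<close>, and if none is missing then
  \<open>K\<close> already contains the whole target.\<close>

lemma exchange:
  fixes w :: "'b \<Rightarrow> nat" and a b :: "'a \<Rightarrow> 'b"
  assumes "finite Q" "inj_on b R" "\<And>q. q \<in> Q \<inter> P \<inter> R \<Longrightarrow> w (b q) \<le> w (a q)"
  shows "\<exists>K. a ` (Q \<inter> P) \<subseteq> K \<and> K \<subseteq> a ` (Q \<inter> P) \<union> b ` (Q \<inter> R) \<and> card K \<le> card Q \<and>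
    sum w (b ` (Q \<inter> R)) \<le> sum w K"
  using assms(1,3)
\<comment> \<open>The minus sign makes the element inserted last the one of least
  \<open>w (b q)\<close>.\<close>
proof (induction Q rule: finite_ranking_induct[where f = "\<lambda>q. - int (w (b q))"])
  case empty
  then show ?case by (intro exI[of _ "{}"]) auto
next
  case (insert q Q)
  show ?case
  proof (cases "q \<in> Q")
    case True
    then have "insert q Q = Q" by auto
    then show ?thesis using insert.IH insert.prems by metis
  next
    case False
    obtain K where K: "a ` (Q \<inter> P) \<subseteq> K" "K \<subseteq> a ` (Q \<inter> P) \<union> b ` (Q \<inter> R)"
      "card K \<le> card Q" "sum w (b ` (Q \<inter> R)) \<le> sum w K"
      using insert.IH insert.prems by (metis Int_iff insertCI)
    have fin: "finite K" using K(2) insert.hyps(1) by (meson finite_Int finite_UnI finite_imageI finite_subset)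
    have card: "card (insert y K) \<le> card (insert q Q)" for y
      using K(3) False insert.hyps(1) fin by (simp add: card_insert_if)
    have grow: "sum w K \<le> sum w (insert y K)" for y
      using fin by (intro sum_mono2) auto
    have b_out: "b q \<notin> b ` (Q \<inter> R)" if "q \<in> R"
      using assms(2) that False by (auto simp: inj_on_def)
    have target: "sum w (b ` (insert q Q \<inter> R)) = (if q \<in> R then w (b q) else 0) + sum w (b ` (Q \<inter> R))"
      using b_out insert.hyps(1) by (simp add: Int_insert_left)
    define a0 where "a0 = (if q \<in> P then {a q} else {})"
    have a_img: "a ` (insert q Q \<inter> P) = a0 \<union> a ` (Q \<inter> P)" by (auto simp: a0_def)
    show ?thesis
    proof (cases "q \<in> P \<and> a q \<notin> K")
      case True
      then have "w (b q) \<le> w (a q)" if "q \<in> R" using insert.prems that by auto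
      then have "sum w (b ` (insert q Q \<inter> R)) \<le> sum w (insert (a q) K)"
        using target K(4) fin True by auto
      then show ?thesis using K(1,2) card True
        by (intro exI[of _ "insert (a q) K"]) auto
    next
      case aK: False
      show ?thesis
      proof (cases "q \<in> R")
        case False
        have "K \<subseteq> a ` (insert q Q \<inter> P) \<union> b ` (insert q Q \<inter> R)" using K(2) by auto
        moreover have "card K \<le> card (insert q Q)" using K(3) \<open>q \<notin> Q\<close> insert.hyps(1) by simp
        ultimately show ?thesis using K aK False target
          by (intro exI[of _ K]) (auto simp: Int_insert_left)
      next
        case qR: True
        show ?thesis
        proof (cases "b ` (insert q Q \<inter> R) \<subseteq> K")
          case True
          have "card K \<le> card (insert q Q)" using K(3) \<open>q \<notin> Q\<close> insert.hyps(1) by simp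
          then show ?thesis using K(1,2) aK True fin
            by (intro exI[of _ K]) (auto intro!: sum_mono2)
        next
          case False
          then obtain y where y: "y \<in> insert q Q \<inter> R" "b y \<notin> K" by auto
          have "w (b q) \<le> w (b y)" using y insert.hyps(2) by auto
          then have "sum w (b ` (insert q Q \<inter> R)) \<le> sum w (insert (b y) K)"
            using target K(4) fin y by auto
          then show ?thesis using K(1,2) aK y card
            by (intro exI[of _ "insert (b y) K"]) auto
        qed
      qed
    qed
  qed
qed

section \<open>Greedy runs, their clusters, and the matching of balls with clusters\<close>

text \<open>A predicate on runs rather than a function, which leaves ties open. \<open>U\<close> is
  the uncovered set, \<open>B\<close> gives the cores that are compared and \<open>E\<close> the
  enlarged balls that are removed. Centres range over all of \<open>X\<close>, covered or not, and
  may repeat.\<close>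

fun greedy :: "('a \<Rightarrow> 'a set) \<Rightarrow> ('a \<Rightarrow> 'a set) \<Rightarrow> ('a \<Rightarrow> nat) \<Rightarrow> 'a set \<Rightarrow> 'a set \<Rightarrow> 'a list \<Rightarrow> bool" where
  "greedy B E w X U [] \<longleftrightarrow> True"
| "greedy B E w X U (c # cs) \<longleftrightarrow>
     c \<in> X \<and> (\<forall>p\<in>X. sum w (B p \<inter> U) \<le> sum w (B c \<inter> U)) \<and> greedy B E w X (U - E c) cs"

text \<open>The first enlarged ball containing \<open>x\<close> is the one that removes
  \<open>x\<close> from the uncovered set, so the fibres of \<open>label\<close> are the clusters; a
  repeated centre keeps its first cluster.\<close>

definition label :: "('a \<Rightarrow> 'a set) \<Rightarrow> 'a list \<Rightarrow> 'a \<Rightarrow> 'a option" where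
  "label E cs x = find (\<lambda>c. x \<in> E c) cs"

lemma label_Cons: "label E (c # cs) x = (if x \<in> E c then Some c else label E cs x)"
  by (simp add: label_def)

lemma label_SomeD: "label E cs x = Some c \<Longrightarrow> c \<in> set cs \<and> x \<in> E c"
  by (auto simp: label_def find_Some_iff)

lemma label_None_iff: "label E cs x = None \<longleftrightarrow> x \<notin> (\<Union>c\<in>set cs. E c)"
  by (auto simp: label_def find_None_iff)

lemma label_snoc:
  "label E (cs @ [c]) x = (if label E cs x = None \<and> x \<in> E c then Some c else label E cs x)"
  by (induction cs) (auto simp: label_def)

text \<open>Peeling centres from the front suits the inductions on runs, whereas the program appends
  its next centre at the end.\<close>

lemma greedy_snoc:
  "greedy B E w X U (cs @ [c]) \<longleftrightarrow> greedy B E w X U cs \<and> c \<in> X \<and>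
    (\<forall>p\<in>X. sum w (B p \<inter> (U - (\<Union>c\<in>set cs. E c))) \<le> sum w (B c \<inter> (U - (\<Union>c\<in>set cs. E c))))"
  by (induction cs arbitrary: U) (auto simp: Diff_eq Int_assoc)

text \<open>A round whose enlarged ball meets \<open>U\<close> shrinks \<open>U\<close>, so
  \<open>card U\<close> such rounds empty it. A round that removes nothing has a core of weight 0,
  hence by maximality all cores have, including the core of \<open>x\<close>, which contains
  \<open>x\<close>.\<close>

lemma greedy_exhausts:
  assumes "greedy B E w X U cs" "finite U" "U \<subseteq> X" "card U \<le> length cs"
    and "\<And>x. x \<in> X \<Longrightarrow> x \<in> B x" "\<And>x. B x \<subseteq> E x"
    and "x \<in> U" "label E cs x = None"
  shows "w x = 0"
  using assms(1-4,7,8)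
proof (induction cs arbitrary: U)
  case Nil
  then show ?case by auto
next
  case (Cons c cs)
  show ?case
  proof (cases "U \<inter> E c = {}")
    case True
    then have "B c \<inter> U = {}" using assms(6) by blast
    then have "sum w (B x \<inter> U) \<le> 0" using Cons.prems by (metis greedy.simps(2) subsetD sum.empty)
    moreover have "x \<in> B x \<inter> U" using Cons.prems assms(5) by auto
    ultimately show ?thesis using Cons.prems(2) by simp
  next
    case False
    then have "card (U - E c) < card U" using Cons.prems(2) by (intro psubset_card_mono) auto
    moreover have "x \<notin> E c" "label E cs x = None" using Cons.prems(6) by (auto simp: label_Cons split: if_splits)
    ultimately show ?thesis using Cons.prems by (intro Cons.IH[of "U - E c"]) auto
  qed
qed

lemma sum_Un_le:
  fixes w :: "'a \<Rightarrow> nat"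
  assumes "finite A" "finite B"
  shows "sum w (A \<union> B) \<le> sum w A + sum w B"
  using sum.union_inter[OF assms, of w] by simp

text \<open>\<open>A\<close> stands for the clusters already served by big balls; their points are
  left out of the weight to be matched. Each remaining cluster that some ball meets is assigned to
  one ball, which then leaves \<open>Q\<close>. The shared point in the conclusion is what later
  bounds the distance between a ball and its cluster.\<close>

lemma greedy_matching:
  fixes w :: "'a \<Rightarrow> nat"
  assumes "greedy B E w X U cs" "finite U" "finite Q" "Q \<subseteq> X"
    and BE: "\<And>p q. p \<in> X \<Longrightarrow> q \<in> X \<Longrightarrow> B p \<inter> B q \<noteq> {} \<Longrightarrow> B q \<subseteq> E p" "\<And>p. p \<in> X \<Longrightarrow> B p \<subseteq> E p"
    and "\<And>x. x \<in> U \<Longrightarrow> label E cs x = None \<Longrightarrow> w x = 0"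
  shows "\<exists>Q' f. Q' \<subseteq> Q \<and> inj_on f Q' \<and>
    (\<forall>q\<in>Q'. f q \<notin> A \<and> (\<exists>x\<in>B q \<inter> U. label E cs x = Some (f q))) \<and>
    sum w {x \<in> U \<inter> (\<Union>q\<in>Q. B q). label E cs x \<notin> Some ` A} \<le>
      (\<Sum>q\<in>Q'. sum w {x \<in> U. label E cs x = Some (f q)})"
  using assms(1-4,7)
proof (induction cs arbitrary: U Q)
  case Nil
  then have "sum w {x \<in> U \<inter> (\<Union>q\<in>Q. B q). label E [] x \<notin> Some ` A} = 0"
    by (intro sum.neutral) (auto simp: label_def)
  then show ?case by (intro exI[of _ "{}"]) auto
next
  case (Cons c cs)
  let ?U = "U - E c"
  have cX: "c \<in> X" using Cons.prems by simp
  have gr: "greedy B E w X ?U cs" "finite ?U" using Cons.prems by auto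
  have zero: "w x = 0" if "x \<in> ?U" "label E cs x = None" for x
    using Cons.prems(5)[of x] that by (auto simp: label_Cons)
  have fresh: "label E cs x \<noteq> Some c" if "x \<in> ?U" for x
    using that label_SomeD by fastforce
  have lab: "{x \<in> U. label E (c # cs) x = Some p} = {x \<in> ?U. label E cs x = Some p}" if "p \<noteq> c" for p
    using that by (auto simp: label_Cons)
  have lab_c: "{x \<in> U. label E (c # cs) x = Some c} = U \<inter> E c"
    using fresh by (auto simp: label_Cons)
  have lift: "\<exists>x\<in>B q \<inter> U. label E (c # cs) x = Some p" if "\<exists>x\<in>B q \<inter> ?U. label E cs x = Some p" for q p
    using that by (auto simp: label_Cons)
  show ?case
  \<comment> \<open>In the first case the new cluster contributes nothing to the left-hand side: its
    points are either excluded through \<open>A\<close> or met by no ball.\<close>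
  proof (cases "c \<in> A \<or> (\<forall>q\<in>Q. B q \<inter> U \<inter> E c = {})")
    case True
    obtain Q' f where *: "Q' \<subseteq> Q" "inj_on f Q'"
      "\<And>q. q \<in> Q' \<Longrightarrow> f q \<notin> A \<and> (\<exists>x\<in>B q \<inter> ?U. label E cs x = Some (f q))"
      "sum w {x \<in> ?U \<inter> (\<Union>q\<in>Q. B q). label E cs x \<notin> Some ` A} \<le>
        (\<Sum>q\<in>Q'. sum w {x \<in> ?U. label E cs x = Some (f q)})"
      using Cons.IH[OF gr Cons.prems(3,4) zero] by blast
    have "f q \<noteq> c" if "q \<in> Q'" for q using *(3)[OF that] fresh by auto
    then have "(\<Sum>q\<in>Q'. sum w {x \<in> U. label E (c # cs) x = Some (f q)}) =
        (\<Sum>q\<in>Q'. sum w {x \<in> ?U. label E cs x = Some (f q)})"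
      by (intro sum.cong refl) (simp add: lab)
    moreover have "{x \<in> U \<inter> (\<Union>q\<in>Q. B q). label E (c # cs) x \<notin> Some ` A} =
        {x \<in> ?U \<inter> (\<Union>q\<in>Q. B q). label E cs x \<notin> Some ` A}"
      using True by (auto simp: label_Cons)
    ultimately show ?thesis using * lift by (intro exI[of _ Q'] exI[of _ f]) auto
  next
    case False
    then have cA: "c \<notin> A" by simp
    txt \<open>The cluster of \<open>c\<close> pays for \<open>q0\<close>.  Either \<open>q0\<close> lies entirely in it, or no ball of \<open>Q\<close> meets
      the core \<open>B c\<close>, which outweighs what is left of \<open>B q0\<close>.\<close>
    obtain q0 where q0: "q0 \<in> Q" "B q0 \<inter> U \<inter> E c \<noteq> {}"
      "B q0 \<inter> B c \<inter> U \<noteq> {} \<or> (\<forall>q\<in>Q. B q \<inter> B c \<inter> U = {})"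
    proof (cases "\<exists>q\<in>Q. B q \<inter> B c \<inter> U \<noteq> {}")
      case True
      then obtain q where "q \<in> Q" "B q \<inter> B c \<inter> U \<noteq> {}" by blast
      moreover then have "B q \<inter> U \<inter> E c \<noteq> {}" using BE(2)[OF cX] by blast
      ultimately show ?thesis using that by blast
    next
      case none: False
      then show ?thesis using that False by blast
    qed
    define R where "R = Q - {q0}"
    have R: "finite R" "R \<subseteq> X" "Q = insert q0 R" "q0 \<notin> R" using Cons.prems(3,4) q0(1) by (auto simp: R_def)
    obtain Q' f where *: "Q' \<subseteq> R" "inj_on f Q'"
      "\<And>q. q \<in> Q' \<Longrightarrow> f q \<notin> A \<and> (\<exists>x\<in>B q \<inter> ?U. label E cs x = Some (f q))"
      "sum w {x \<in> ?U \<inter> (\<Union>q\<in>R. B q). label E cs x \<notin> Some ` A} \<le>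
        (\<Sum>q\<in>Q'. sum w {x \<in> ?U. label E cs x = Some (f q)})"
      using Cons.IH[OF gr R(1,2) zero] by blast
    have fc: "f q \<noteq> c" if "q \<in> Q'" for q using *(3)[OF that] fresh by auto
    define g where "g = f(q0 := c)"
    have q0Q': "q0 \<notin> Q'" using *(1) R by auto
    have gf: "g q = f q" if "q \<in> Q'" for q using that q0Q' by (auto simp: g_def)
    have finQ': "finite Q'" using *(1) R(1) finite_subset by blast
    have "inj_on g (insert q0 Q')"
      using *(2) gf fc q0Q' by (fastforce simp: inj_on_def g_def)
    moreover have "\<forall>q\<in>insert q0 Q'. g q \<notin> A \<and> (\<exists>x\<in>B q \<inter> U. label E (c # cs) x = Some (g q))"
    proof
      fix q assume "q \<in> insert q0 Q'"
      then consider "q = q0" | "q \<in> Q'" by blast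
      then show "g q \<notin> A \<and> (\<exists>x\<in>B q \<inter> U. label E (c # cs) x = Some (g q))"
      proof cases
        case 1
        then show ?thesis using q0(2) cA by (auto simp: g_def label_Cons)
      next
        case 2
        then show ?thesis using *(3)[OF 2] lift gf by simp
      qed
    qed
    moreover have "sum w {x \<in> U \<inter> (\<Union>q\<in>Q. B q). label E (c # cs) x \<notin> Some ` A}
        \<le> (\<Sum>q\<in>insert q0 Q'. sum w {x \<in> U. label E (c # cs) x = Some (g q)})"
    proof -
      \<comment> \<open>The new cluster has to pay for \<open>D\<close>, the part of it taken by all
        balls together, and also for what \<open>q0\<close> covers outside it, because
        \<open>q0\<close> takes no further part. If no ball meets the core of \<open>c\<close>, then
        \<open>D\<close> and the core are disjoint parts of the cluster.\<close>
      define D where "D = U \<inter> E c \<inter> (\<Union>q\<in>Q. B q)"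
      define Z where "Z = {x \<in> ?U \<inter> (\<Union>q\<in>R. B q). label E cs x \<notin> Some ` A}"
      have fin: "finite D" "finite Z" "finite (B q0 \<inter> ?U)" using Cons.prems(2) by (auto simp: D_def Z_def)
      have "{x \<in> U \<inter> (\<Union>q\<in>Q. B q). label E (c # cs) x \<notin> Some ` A} \<subseteq> D \<union> (B q0 \<inter> ?U) \<union> Z"
        unfolding R(3) D_def Z_def by (auto simp: label_Cons split: if_splits)
      then have "sum w {x \<in> U \<inter> (\<Union>q\<in>Q. B q). label E (c # cs) x \<notin> Some ` A} \<le> sum w (D \<union> (B q0 \<inter> ?U) \<union> Z)"
        using fin by (intro sum_mono2) auto
      also have "\<dots> \<le> sum w D + sum w (B q0 \<inter> ?U) + sum w Z"
        using sum_Un_le[of "D \<union> (B q0 \<inter> ?U)" Z w] sum_Un_le[of D "B q0 \<inter> ?U" w] fin by simp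
      also have "sum w D + sum w (B q0 \<inter> ?U) \<le> sum w (U \<inter> E c)"
      proof (cases "B q0 \<inter> B c \<inter> U = {}")
        case True
        then have sep: "D \<inter> (B c \<inter> U) = {}" using q0(3) by (auto simp: D_def)
        have "sum w (B q0 \<inter> ?U) \<le> sum w (B q0 \<inter> U)" using Cons.prems(2) by (intro sum_mono2) auto
        also have "\<dots> \<le> sum w (B c \<inter> U)" using Cons.prems(1,4) q0(1) by auto
        finally have "sum w D + sum w (B q0 \<inter> ?U) \<le> sum w D + sum w (B c \<inter> U)" by simp
        also have "\<dots> = sum w (D \<union> (B c \<inter> U))" using fin Cons.prems(2) sep by (subst sum.union_disjoint) auto
        also have "\<dots> \<le> sum w (U \<inter> E c)" using Cons.prems(2) BE(2)[OF cX] by (intro sum_mono2) (auto simp: D_def)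
        finally show ?thesis .
      next
        case False
        then have "B q0 \<subseteq> E c" using BE(1)[OF cX, of q0] Cons.prems(4) q0(1) by blast
        then have "B q0 \<inter> ?U = {}" by auto
        moreover have "sum w D \<le> sum w (U \<inter> E c)" using Cons.prems(2) by (intro sum_mono2) (auto simp: D_def)
        ultimately show ?thesis by simp
      qed
      also have "sum w (U \<inter> E c) + sum w Z \<le> sum w (U \<inter> E c) + (\<Sum>q\<in>Q'. sum w {x \<in> ?U. label E cs x = Some (f q)})"
        using *(4) by (simp add: Z_def)
      also have "(\<Sum>q\<in>Q'. sum w {x \<in> ?U. label E cs x = Some (f q)}) =
          (\<Sum>q\<in>Q'. sum w {x \<in> U. label E (c # cs) x = Some (g q)})"
        by (intro sum.cong refl) (simp add: lab fc gf)
      also have "sum w (U \<inter> E c) + \<dots> = (\<Sum>q\<in>insert q0 Q'. sum w {x \<in> U. label E (c # cs) x = Some (g q)})"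
        using finQ' q0Q' by (simp add: lab_c g_def)
      finally show ?thesis by simp
    qed
    ultimately show ?thesis using *(1) R(3) by (intro exI[of _ "insert q0 Q'"] exI[of _ g]) auto
  qed
qed

section \<open>The reduction and its two directions\<close>

definition near :: "'a cnukc \<Rightarrow> real \<Rightarrow> 'a \<Rightarrow> 'a set" where
  "near I k p = {x \<in> pts I. metr I p x \<le> k * rad2 I}"

definition cluster_weight :: "'a cnukc \<Rightarrow> ('a \<Rightarrow> nat) \<Rightarrow> 'a list \<Rightarrow> 'a \<Rightarrow> nat" where
  "cluster_weight I w cs p = sum w {x \<in> pts I. label (near I 3) cs x = Some p}"

text \<open>As many rounds as points are enough by \<open>greedy_exhausts\<close>. The favourite
  \<open>F\<close> is defined on all points: one that is not a centre of \<open>cs\<close> has an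
  empty red cluster and ships nothing.\<close>

definition reduction :: "'a cnukc \<Rightarrow> ('a \<Rightarrow> nat) \<Rightarrow> ('a \<Rightarrow> nat) \<Rightarrow> bool" where
  "reduction I \<chi>r \<chi>b \<longleftrightarrow> (\<exists>cs bs F.
     greedy (near I 1) (near I 3) (red I) (pts I) (pts I) cs \<and> length cs = card (pts I) \<and>
     greedy (near I 1) (near I 3) (blue I) (pts I) (pts I) bs \<and> length bs = card (pts I) \<and>
     (\<forall>p\<in>pts I. F p \<in> near I 8 p \<and>
        (\<forall>j\<in>near I 8 p. cluster_weight I (blue I) bs j \<le> cluster_weight I (blue I) bs (F p))) \<and>
     (\<forall>z\<in>pts I. \<chi>r z = (\<Sum>p\<in>{p \<in> pts I. F p = z}. cluster_weight I (red I) cs p)) \<and>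
     (\<forall>z\<in>pts I. \<chi>b z = cluster_weight I (blue I) bs z))"

lemma greedy_subset: "greedy B E w X U cs \<Longrightarrow> set cs \<subseteq> X"
  by (induction cs arbitrary: U) auto

lemma cluster_weight_sum:
  assumes "finite (pts I)" "finite A"
  shows "(\<Sum>p\<in>A. cluster_weight I w cs p) = sum w {x \<in> pts I. label (near I 3) cs x \<in> Some ` A}"
proof -
  have "{x \<in> pts I. label (near I 3) cs x \<in> Some ` A} = (\<Union>p\<in>A. {x \<in> pts I. label (near I 3) cs x = Some p})"
    by auto
  then show ?thesis using assms unfolding cluster_weight_def
    by (simp add: sum.UNION_disjoint disjoint_iff)
qed

lemma unlabelled_weight:
  assumes "cnukc_instance I" "greedy (near I 1) (near I 3) w (pts I) (pts I) cs" "length cs = card (pts I)"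
    "x \<in> pts I" "label (near I 3) cs x = None"
  shows "w x = 0"
proof (rule greedy_exhausts[OF assms(2) _ order_refl _ _ _ assms(4,5)])
  interpret Metric_space "pts I" "metr I" using assms(1) by (simp add: cnukc_instance_def)
  have r: "rad2 I \<ge> 0" "finite (pts I)" using assms(1) by (auto simp: cnukc_instance_def)
  show "finite (pts I)" "card (pts I) \<le> length cs" using r assms(3) by auto
  show "p \<in> near I 1 p" if "p \<in> pts I" for p using that r by (simp add: near_def)
  show "near I 1 p \<subseteq> near I 3 p" for p using r by (auto simp: near_def)
qed

text \<open>The factor 3 is what makes a unit ball that meets the core of \<open>p\<close> lie
  inside the enlarged ball of \<open>p\<close>. The factor 4 is 3 + 1, through the common point of
  the ball and the cluster.\<close>

lemma matching_near:
  assumes "cnukc_instance I" "greedy (near I 1) (near I 3) w (pts I) (pts I) cs" "length cs = card (pts I)"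
    "finite Q" "Q \<subseteq> pts I"
  shows "\<exists>Q' f. Q' \<subseteq> Q \<and> inj_on f Q' \<and> (\<forall>q\<in>Q'. f q \<in> pts I \<and> f q \<notin> A \<and> metr I (f q) q \<le> 4 * rad2 I) \<and>
    sum w {x \<in> (\<Union>q\<in>Q. near I 1 q). label (near I 3) cs x \<notin> Some ` A} \<le> (\<Sum>q\<in>Q'. cluster_weight I w cs (f q))"
proof -
  interpret Metric_space "pts I" "metr I" using assms(1) by (simp add: cnukc_instance_def)
  have r: "rad2 I \<ge> 0" "finite (pts I)" using assms(1) by (auto simp: cnukc_instance_def)
  have 1: "near I 1 q \<subseteq> near I 3 p" if "p \<in> pts I" "q \<in> pts I" "near I 1 p \<inter> near I 1 q \<noteq> {}" for p q
  proof
    fix x assume x: "x \<in> near I 1 q"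
    from that(3) obtain y where y: "y \<in> near I 1 p" "y \<in> near I 1 q" by blast
    have "metr I p x \<le> metr I p y + metr I y q + metr I q x"
      using triangle[of p y x] triangle[of y q x] x y that by (auto simp: near_def)
    then show "x \<in> near I 3 p" using x y commute by (auto simp: near_def)
  qed
  have 2: "near I 1 p \<subseteq> near I 3 p" for p
    using r by (auto simp: near_def)
  have 3: "w x = 0" if "x \<in> pts I" "label (near I 3) cs x = None" for x
    using unlabelled_weight[OF assms(1-3) that] .
  have "\<exists>Q' f. Q' \<subseteq> Q \<and> inj_on f Q' \<and>
    (\<forall>q\<in>Q'. f q \<notin> A \<and> (\<exists>x\<in>near I 1 q \<inter> pts I. label (near I 3) cs x = Some (f q))) \<and>
    sum w {x \<in> pts I \<inter> (\<Union>q\<in>Q. near I 1 q). label (near I 3) cs x \<notin> Some ` A} \<le>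
      (\<Sum>q\<in>Q'. sum w {x \<in> pts I. label (near I 3) cs x = Some (f q)})"
    by (rule greedy_matching[OF assms(2) r(2) assms(4,5)]) (use 1 in blast, use 2 in blast, use 3 in blast)
  then obtain Q' f where *: "Q' \<subseteq> Q" "inj_on f Q'"
    "\<And>q. q \<in> Q' \<Longrightarrow> f q \<notin> A \<and> (\<exists>x\<in>near I 1 q \<inter> pts I. label (near I 3) cs x = Some (f q))"
    "sum w {x \<in> pts I \<inter> (\<Union>q\<in>Q. near I 1 q). label (near I 3) cs x \<notin> Some ` A} \<le>
      (\<Sum>q\<in>Q'. sum w {x \<in> pts I. label (near I 3) cs x = Some (f q)})"
    by blast
  have csX: "set cs \<subseteq> pts I" using greedy_subset[OF assms(2)] .
  have "f q \<in> pts I \<and> f q \<notin> A \<and> metr I (f q) q \<le> 4 * rad2 I" if q: "q \<in> Q'" for q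
  proof -
    obtain x where x: "x \<in> near I 1 q" "label (near I 3) cs x = Some (f q)" using *(3)[OF q] by blast
    have f: "f q \<in> pts I" "x \<in> near I 3 (f q)" using label_SomeD[OF x(2)] csX by auto
    have "q \<in> pts I" using q *(1) assms(5) by auto
    then have "metr I (f q) q \<le> metr I (f q) x + metr I q x"
      using triangle'' triangle[of "f q" x q] commute[of x q] f x by (auto simp: near_def)
    then show ?thesis using f x *(3)[OF q] by (auto simp: near_def)
  qed
  moreover have "pts I \<inter> (\<Union>q\<in>Q. near I 1 q) = (\<Union>q\<in>Q. near I 1 q)" by (auto simp: near_def)
  ultimately show ?thesis using * unfolding cluster_weight_def by (intro exI[of _ Q'] exI[of _ f]) auto
qed

lemma covered_transformed:
  "covered (I\<lparr>red := a, blue := b, rad1 := c, rad2 := d\<rparr>) = covered I"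
  by (intro ext) (simp add: covered_def)

text \<open>The big centres are kept and the small ones replaced by the set \<open>K\<close> of
  \<open>exchange\<close>, applied with \<open>a\<close> the favourite of the matched red cluster
  and \<open>b\<close> the matched blue cluster. Weight inside old big balls is recovered in
  \<open>A\<close>, the rest in \<open>K\<close>.\<close>

lemma reduction_feasible:
  assumes inst: "cnukc_instance I" and red: "reduction I \<chi>r \<chi>b" and feas: "feasible_solution I S"
  shows "\<exists>S'. feasible_solution (I\<lparr>red := \<chi>r, blue := \<chi>b, rad1 := rad1 I + 26 * rad2 I, rad2 := 0\<rparr>) S'"
proof -
  interpret Metric_space "pts I" "metr I" using inst by (simp add: cnukc_instance_def)
  have r: "rad2 I \<ge> 0" "finite (pts I)" using inst by (auto simp: cnukc_instance_def)
  obtain cs bs F where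
    cs: "greedy (near I 1) (near I 3) (red I) (pts I) (pts I) cs" "length cs = card (pts I)" and
    bs: "greedy (near I 1) (near I 3) (blue I) (pts I) (pts I) bs" "length bs = card (pts I)" and
    F: "\<And>p. p \<in> pts I \<Longrightarrow> F p \<in> near I 8 p"
      "\<And>p j. p \<in> pts I \<Longrightarrow> j \<in> near I 8 p \<Longrightarrow> cluster_weight I (blue I) bs j \<le> cluster_weight I (blue I) bs (F p)" and
    \<chi>r: "\<And>z. z \<in> pts I \<Longrightarrow> \<chi>r z = (\<Sum>p\<in>{p \<in> pts I. F p = z}. cluster_weight I (red I) cs p)" and
    \<chi>b: "\<And>z. z \<in> pts I \<Longrightarrow> \<chi>b z = cluster_weight I (blue I) bs z"
    using red unfolding reduction_def by blast
  have mcball_zero: "mcball p 0 = {p}" if "p \<in> pts I" for p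
  proof -
    have "metr I p x \<le> 0 \<longleftrightarrow> x = p" if "x \<in> pts I" for x
      using that \<open>p \<in> pts I\<close> nonneg[of p x] zero[of p x] by (metis order.antisym order_refl)
    then show ?thesis using that by (auto simp: mcball_def)
  qed
  obtain P Q where S: "S = (P, Q)" by (cases S)
  have PQ: "P \<subseteq> pts I" "card P \<le> k1 I" "Q \<subseteq> pts I" "card Q \<le> k2 I"
    and cov: "int (sum (red I) (covered I (rad1 I) (rad2 I) S)) \<ge> m_red I"
      "int (sum (blue I) (covered I (rad1 I) (rad2 I) S)) \<ge> m_blue I"
    using feas by (auto simp: feasible_solution_def solution_with_radii_def S simp del: of_nat_sum)
  have finQ: "finite Q" using PQ(3) r finite_subset by blast
  define A where "A = (\<Union>p\<in>P. mcball p (rad1 I + 26 * rad2 I))"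
  have A: "A \<subseteq> pts I" "finite A" using r(2) by (auto simp: A_def mcball_def intro: finite_subset)
  \<comment> \<open>Red weight is counted at the favourite, so whether a red cluster is served by
    the big balls depends on the position of \<open>F p\<close>, not of \<open>p\<close>.\<close>
  define G where "G = {p \<in> pts I. F p \<in> A}"
  have G: "G \<subseteq> pts I" "finite G" using r(2) by (auto simp: G_def)
  have cov_sub: "covered I (rad1 I) (rad2 I) S \<subseteq> pts I"
    by (auto simp: covered_def mcball_def)
  have csX: "set cs \<subseteq> pts I" "set bs \<subseteq> pts I" using greedy_subset cs(1) bs(1) by blast+
  have bigA: "z \<in> A" if "p \<in> P" "x \<in> mcball p (rad1 I)" "z \<in> pts I" "metr I z x \<le> 26 * rad2 I" for p x z
  proof -
    have "metr I p z \<le> metr I p x + metr I z x"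
      using triangle[of p x z] commute[of x z] that by (auto simp: mcball_def)
    then have "z \<in> mcball p (rad1 I + 26 * rad2 I)" using that by (auto simp: mcball_def)
    then show ?thesis using that(1) by (auto simp: A_def)
  qed
  obtain Q1 f where f: "Q1 \<subseteq> Q" "inj_on f Q1"
    "\<And>q. q \<in> Q1 \<Longrightarrow> f q \<in> pts I \<and> f q \<notin> G \<and> metr I (f q) q \<le> 4 * rad2 I"
    "sum (red I) {x \<in> (\<Union>q\<in>Q. near I 1 q). label (near I 3) cs x \<notin> Some ` G} \<le> (\<Sum>q\<in>Q1. cluster_weight I (red I) cs (f q))"
    using matching_near[OF inst cs finQ PQ(3), of G] by blast
  obtain Q2 g where g: "Q2 \<subseteq> Q" "inj_on g Q2"
    "\<And>q. q \<in> Q2 \<Longrightarrow> g q \<in> pts I \<and> g q \<notin> A \<and> metr I (g q) q \<le> 4 * rad2 I"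
    "sum (blue I) {x \<in> (\<Union>q\<in>Q. near I 1 q). label (near I 3) bs x \<notin> Some ` A} \<le> (\<Sum>q\<in>Q2. cluster_weight I (blue I) bs (g q))"
    using matching_near[OF inst bs finQ PQ(3), of A] by blast
  let ?wb = "cluster_weight I (blue I) bs" and ?wr = "cluster_weight I (red I) cs"
  \<comment> \<open>Both clusters are within 4 of the same ball, so \<open>g q\<close> was a
    candidate when the favourite of \<open>f q\<close> was chosen.\<close>
  have "?wb (g q) \<le> ?wb (F (f q))" if q: "q \<in> Q1" "q \<in> Q2" for q
  proof -
    have qX: "q \<in> pts I" using f(1) PQ(3) q by blast
    have "metr I (f q) (g q) \<le> metr I (f q) q + metr I (g q) q"
      using triangle[of "f q" q "g q"] commute[of q "g q"] f(3)[OF q(1)] g(3)[OF q(2)] qX by simp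
    then have "g q \<in> near I 8 (f q)" using f(3) g(3) q by (fastforce simp: near_def)
    then show ?thesis using F(2) f(3) q by blast
  qed
  then obtain K where K: "(F \<circ> f) ` (Q \<inter> Q1) \<subseteq> K" "K \<subseteq> (F \<circ> f) ` (Q \<inter> Q1) \<union> g ` (Q \<inter> Q2)"
      "card K \<le> card Q" "sum ?wb (g ` (Q \<inter> Q2)) \<le> sum ?wb K"
    using exchange[OF finQ g(2), of Q1 ?wb "F \<circ> f"] by auto
  have QQ: "Q \<inter> Q1 = Q1" "Q \<inter> Q2 = Q2" using f(1) g(1) by auto
  have Ff: "F (f q) \<in> pts I - A" if "q \<in> Q1" for q
    using f(3)[OF that] F(1) by (auto simp: G_def near_def)
  \<comment> \<open>Favourites of clusters outside \<open>G\<close> avoid \<open>A\<close>, and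
    \<open>g\<close> avoids \<open>A\<close> by construction; hence the blue weights of
    \<open>A\<close> and \<open>K\<close> add up without overlap.\<close>
  have KA: "K \<subseteq> pts I - A" using K(2) Ff g(3) unfolding QQ by auto
  have finK: "finite K" using KA r(2) finite_subset by blast
  define S' where "S' = (P, K)"
  let ?J = "I\<lparr>red := \<chi>r, blue := \<chi>b, rad1 := rad1 I + 26 * rad2 I, rad2 := 0\<rparr>"
  have covS': "covered I (rad1 I + 26 * rad2 I) 0 S' = A \<union> K"
  proof -
    have "(\<Union>p\<in>K. mcball p 0) = K" using KA mcball_zero by auto
    then show ?thesis by (simp add: covered_def S'_def A_def)
  qed
  have AK: "A \<union> K \<subseteq> pts I" "finite (A \<union> K)" using A finK KA by auto
  have "sum (red I) (covered I (rad1 I) (rad2 I) S) \<le> sum \<chi>r (A \<union> K)"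
  proof -
    let ?free = "{x \<in> pts I. label (near I 3) cs x \<in> Some ` G}"
    let ?rest = "{x \<in> (\<Union>q\<in>Q. near I 1 q). label (near I 3) cs x \<notin> Some ` G}"
    have zero: "red I x = 0" if "x \<in> pts I" "label (near I 3) cs x = None" for x
      using unlabelled_weight[OF inst cs that] .
    \<comment> \<open>Going from \<open>x\<close> to its cluster centre and on to the favourite
      costs 3 + 8 = 11, so the enlarged big ball reaches the favourite.\<close>
    have in_free: "x \<in> ?free" if "p \<in> P" "x \<in> mcball p (rad1 I)" "label (near I 3) cs x \<noteq> None" for p x
    proof -
      from that(3) obtain c where c: "label (near I 3) cs x = Some c" by auto
      have cX: "c \<in> pts I" "x \<in> near I 3 c" using label_SomeD[OF c] csX by auto
      then have "F c \<in> pts I" "metr I c (F c) \<le> 8 * rad2 I" using F(1) by (auto simp: near_def)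
      moreover have "metr I (F c) x \<le> metr I c (F c) + metr I c x"
        using triangle[of "F c" c x] commute[of c "F c"] cX calculation by (auto simp: near_def)
      ultimately have "F c \<in> A" using bigA[OF that(1,2)] cX r(1) by (auto simp: near_def)
      then show ?thesis using c cX by (auto simp: G_def near_def)
    qed
    have "sum (red I) (covered I (rad1 I) (rad2 I) S) = sum (red I) {x \<in> covered I (rad1 I) (rad2 I) S. label (near I 3) cs x \<noteq> None}"
    proof (intro sum.mono_neutral_right ballI)
      show "finite (covered I (rad1 I) (rad2 I) S)" using cov_sub r(2) finite_subset by blast
    qed (use cov_sub zero in auto)
    also have "\<dots> \<le> sum (red I) (?free \<union> ?rest)"
    proof (intro sum_mono2 subsetI)
      show "finite (?free \<union> ?rest)" using r(2) by (rule finite_subset[rotated]) (auto simp: near_def)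
    next
      fix x assume x: "x \<in> {x \<in> covered I (rad1 I) (rad2 I) S. label (near I 3) cs x \<noteq> None}"
      then consider p where "p \<in> P" "x \<in> mcball p (rad1 I)" | q where "q \<in> Q" "x \<in> mcball q (rad2 I)"
        by (auto simp: covered_def S)
      then show "x \<in> ?free \<union> ?rest"
      proof cases
        case 1
        then show ?thesis using in_free x by blast
      next
        case 2
        then show ?thesis by (auto simp: near_def mcball_def)
      qed
    qed auto
    also have "\<dots> \<le> sum (red I) ?free + sum (red I) ?rest"
      using r(2) by (intro sum_Un_le) (auto intro: finite_subset[of _ "pts I"] simp: near_def)
    also have "\<dots> \<le> sum ?wr G + (\<Sum>q\<in>Q1. ?wr (f q))"
      using f(4) cluster_weight_sum[OF r(2) G(2)] by simp
    also have "(\<Sum>q\<in>Q1. ?wr (f q)) = sum ?wr (f ` Q1)" using f(2) by (simp add: sum.reindex)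
    also have "sum ?wr G + \<dots> = sum ?wr (G \<union> f ` Q1)"
      using G(2) f(1,3) finQ by (subst sum.union_disjoint) (auto intro: finite_subset)
    \<comment> \<open>Other red clusters may share these favourites and are gained as well. Grouping
      by favourite then yields \<open>\<chi>r\<close>.\<close>
    also have "\<dots> \<le> sum ?wr {p \<in> pts I. F p \<in> A \<union> K}"
      using r(2) f(3) K(1) QQ by (intro sum_mono2) (auto simp: G_def)
    also have "{p \<in> pts I. F p \<in> A \<union> K} = (\<Union>z\<in>A \<union> K. {p \<in> pts I. F p = z})" by auto
    also have "sum ?wr \<dots> = (\<Sum>z\<in>A \<union> K. sum ?wr {p \<in> pts I. F p = z})"
      using AK r(2) by (intro sum.UNION_disjoint) auto
    also have "\<dots> = sum \<chi>r (A \<union> K)" using AK \<chi>r by (intro sum.cong) auto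
    finally show ?thesis .
  qed
  moreover have "sum (blue I) (covered I (rad1 I) (rad2 I) S) \<le> sum \<chi>b (A \<union> K)"
  proof -
    let ?free = "{x \<in> pts I. label (near I 3) bs x \<in> Some ` A}"
    let ?rest = "{x \<in> (\<Union>q\<in>Q. near I 1 q). label (near I 3) bs x \<notin> Some ` A}"
    have zero: "blue I x = 0" if "x \<in> pts I" "label (near I 3) bs x = None" for x
      using unlabelled_weight[OF inst bs that] .
    have in_free: "x \<in> ?free" if "p \<in> P" "x \<in> mcball p (rad1 I)" "label (near I 3) bs x \<noteq> None" for p x
    proof -
      from that(3) obtain c where c: "label (near I 3) bs x = Some c" by auto
      have cX: "c \<in> pts I" "x \<in> near I 3 c" using label_SomeD[OF c] csX by auto
      then have "c \<in> A" using bigA[OF that(1,2)] r(1) by (auto simp: near_def)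
      then show ?thesis using c cX by (auto simp: near_def)
    qed
    have "sum (blue I) (covered I (rad1 I) (rad2 I) S) = sum (blue I) {x \<in> covered I (rad1 I) (rad2 I) S. label (near I 3) bs x \<noteq> None}"
    proof (intro sum.mono_neutral_right ballI)
      show "finite (covered I (rad1 I) (rad2 I) S)" using cov_sub r(2) finite_subset by blast
    qed (use cov_sub zero in auto)
    also have "\<dots> \<le> sum (blue I) (?free \<union> ?rest)"
    proof (intro sum_mono2 subsetI)
      show "finite (?free \<union> ?rest)" using r(2) by (rule finite_subset[rotated]) (auto simp: near_def)
    next
      fix x assume x: "x \<in> {x \<in> covered I (rad1 I) (rad2 I) S. label (near I 3) bs x \<noteq> None}"
      then consider p where "p \<in> P" "x \<in> mcball p (rad1 I)" | q where "q \<in> Q" "x \<in> mcball q (rad2 I)"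
        by (auto simp: covered_def S)
      then show "x \<in> ?free \<union> ?rest"
      proof cases
        case 1
        then show ?thesis using in_free x by blast
      next
        case 2
        then show ?thesis by (auto simp: near_def mcball_def)
      qed
    qed auto
    also have "\<dots> \<le> sum (blue I) ?free + sum (blue I) ?rest"
      using r(2) by (intro sum_Un_le) (auto intro: finite_subset[of _ "pts I"] simp: near_def)
    also have "\<dots> \<le> sum ?wb A + (\<Sum>q\<in>Q2. ?wb (g q))"
      using g(4) cluster_weight_sum[OF r(2) A(2)] by simp
    also have "(\<Sum>q\<in>Q2. ?wb (g q)) = sum ?wb (g ` Q2)" using g(2) by (simp add: sum.reindex)
    also have "sum ?wb A + \<dots> \<le> sum ?wb A + sum ?wb K" using K(4) QQ by simp
    also have "\<dots> = sum ?wb (A \<union> K)" using A finK KA by (subst sum.union_disjoint) auto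
    also have "\<dots> = sum \<chi>b (A \<union> K)" using AK \<chi>b by (intro sum.cong) auto
    finally show ?thesis .
  qed
  ultimately have "feasible_solution ?J S'"
    using PQ K(3) KA cov unfolding feasible_solution_def solution_with_radii_def
    by (auto simp: covered_transformed covS' simp del: of_nat_sum) (auto simp: S'_def)
  then show ?thesis by blast
qed

text \<open>Distinct points of \<open>Y\<close> count disjoint sets of points, all of them close to
  where they are counted, so it suffices that the enlarged balls reach these points.\<close>

lemma reduction_approx:
  assumes inst: "cnukc_instance I" and red: "reduction I \<chi>r \<chi>b" and "\<alpha> \<ge> 1"
    and sol: "approx_solution \<alpha> (I\<lparr>red := \<chi>r, blue := \<chi>b, rad1 := rad1 I + 26 * rad2 I, rad2 := 0\<rparr>) S"
  shows "approx_solution (53 * \<alpha>) I S"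
proof -
  interpret Metric_space "pts I" "metr I" using inst by (simp add: cnukc_instance_def)
  have r: "rad2 I \<ge> 0" "rad2 I \<le> rad1 I" "finite (pts I)" using inst by (auto simp: cnukc_instance_def)
  obtain cs bs F where
    cs: "greedy (near I 1) (near I 3) (red I) (pts I) (pts I) cs" and
    bs: "greedy (near I 1) (near I 3) (blue I) (pts I) (pts I) bs" and
    F: "\<And>p. p \<in> pts I \<Longrightarrow> F p \<in> near I 8 p" and
    \<chi>r: "\<And>z. z \<in> pts I \<Longrightarrow> \<chi>r z = (\<Sum>p\<in>{p \<in> pts I. F p = z}. cluster_weight I (red I) cs p)" and
    \<chi>b: "\<And>z. z \<in> pts I \<Longrightarrow> \<chi>b z = cluster_weight I (blue I) bs z"
    using red unfolding reduction_def by blast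
  have mcball_zero: "mcball p 0 = {p}" if "p \<in> pts I" for p
  proof -
    have "metr I p x \<le> 0 \<longleftrightarrow> x = p" if "x \<in> pts I" for x
      using that \<open>p \<in> pts I\<close> nonneg[of p x] zero[of p x] by (metis order.antisym order_refl)
    then show ?thesis using that by (auto simp: mcball_def)
  qed
  define Y where "Y = covered I (\<alpha> * (rad1 I + 26 * rad2 I)) 0 S"
  define Z where "Z = covered I (53 * \<alpha> * rad1 I) (53 * \<alpha> * rad2 I) S"
  have Y: "Y \<subseteq> pts I" "finite Y" and Z: "Z \<subseteq> pts I" "finite Z"
    using r(3) by (auto simp: Y_def Z_def covered_def mcball_def intro: finite_subset)
  \<comment> \<open>A big ball needs \<open>\<alpha> * (r1 + 26 * r2) + 26 * r2\<close>, at most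
    \<open>53 * \<alpha> * r1\<close> because \<open>r2 \<le> r1\<close> and
    \<open>\<alpha> \<ge> 1\<close>. At level 2 the point \<open>z\<close> is itself a centre, and
    \<open>26 * r2\<close> suffices.\<close>
  have close: "x \<in> Z" if "z \<in> Y" "x \<in> pts I" "metr I z x \<le> 26 * rad2 I" for x z
  proof -
    have \<alpha>r: "rad2 I \<le> \<alpha> * rad2 I" "\<alpha> * rad2 I \<le> \<alpha> * rad1 I" "0 \<le> \<alpha> * rad2 I"
      using r \<open>\<alpha> \<ge> 1\<close> by (auto intro!: mult_left_mono simp: mult_le_cancel_right1)
    have zY: "(\<exists>p\<in>fst S. z \<in> mcball p (\<alpha> * (rad1 I + 26 * rad2 I))) \<or> (\<exists>p\<in>snd S. z \<in> mcball p 0)"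
      using that(1) unfolding Y_def covered_def by blast
    consider (1) p where "p \<in> fst S" "z \<in> mcball p (\<alpha> * (rad1 I + 26 * rad2 I))" | (2) "z \<in> snd S"
    proof -
      have "z = p" if "z \<in> mcball p 0" for p using that mcball_zero by (auto simp: mcball_def)
      then show thesis using zY 1 2 by blast
    qed
    then show ?thesis
    proof cases
      case 1
      then have "metr I p x \<le> metr I p z + metr I z x"
        using triangle[of p z x] that by (auto simp: mcball_def)
      also have "\<dots> \<le> 53 * \<alpha> * rad1 I"
        using 1(2) that(3) \<alpha>r by (auto simp: mcball_def algebra_simps)
      finally have "x \<in> mcball p (53 * \<alpha> * rad1 I)"
        using 1(2) that(2) by (auto simp: mcball_def)
      then show ?thesis using 1(1) by (auto simp: Z_def covered_def)
    next
      case 2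
      then have "x \<in> mcball z (53 * \<alpha> * rad2 I)"
        using that Y(1) \<alpha>r by (auto simp: mcball_def algebra_simps)
      then show ?thesis using 2 by (auto simp: Z_def covered_def)
    qed
  qed
  have red_le: "sum \<chi>r Y \<le> sum (red I) Z"
  proof -
    have "sum \<chi>r Y = (\<Sum>z\<in>Y. \<Sum>p\<in>{p \<in> pts I. F p = z}. cluster_weight I (red I) cs p)"
      using \<chi>r Y by (intro sum.cong) auto
    also have "\<dots> = (\<Sum>p\<in>(\<Union>z\<in>Y. {p \<in> pts I. F p = z}). cluster_weight I (red I) cs p)"
      using Y r(3) by (intro sum.UNION_disjoint[symmetric]) auto
    also have "\<dots> = sum (red I) {x \<in> pts I. label (near I 3) cs x \<in> Some ` (\<Union>z\<in>Y. {p \<in> pts I. F p = z})}"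
      using Y r(3) by (intro cluster_weight_sum) auto
    also have "\<dots> \<le> sum (red I) Z"
    proof (intro sum_mono2 subsetI Z)
      fix x assume "x \<in> {x \<in> pts I. label (near I 3) cs x \<in> Some ` (\<Union>z\<in>Y. {p \<in> pts I. F p = z})}"
      then obtain p where p: "x \<in> pts I" "p \<in> pts I" "F p \<in> Y" "label (near I 3) cs x = Some p" by auto
      have px: "metr I p x \<le> 3 * rad2 I" using label_SomeD[OF p(4)] by (auto simp: near_def)
      have "metr I (F p) x \<le> metr I p (F p) + metr I p x"
        using triangle[of "F p" p x] commute[of p "F p"] F[OF p(2)] p by (auto simp: near_def)
      then show "x \<in> Z" using close[OF p(3,1)] px F[OF p(2)] r(1) by (auto simp: near_def)
    qed auto
    finally show ?thesis .
  qed
  have blue_le: "sum \<chi>b Y \<le> sum (blue I) Z"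
  proof -
    have "sum \<chi>b Y = (\<Sum>z\<in>Y. cluster_weight I (blue I) bs z)"
      using \<chi>b Y by (intro sum.cong) auto
    also have "\<dots> = sum (blue I) {x \<in> pts I. label (near I 3) bs x \<in> Some ` Y}"
      using Y r(3) by (intro cluster_weight_sum) auto
    also have "\<dots> \<le> sum (blue I) Z"
    proof (intro sum_mono2 subsetI Z)
      fix x assume "x \<in> {x \<in> pts I. label (near I 3) bs x \<in> Some ` Y}"
      then obtain z where z: "x \<in> pts I" "z \<in> Y" "label (near I 3) bs x = Some z" by auto
      then show "x \<in> Z" using close[OF z(2,1)] label_SomeD[OF z(3)] r(1) by (auto simp: near_def)
    qed auto
    finally show ?thesis .
  qed
  show ?thesis
    using sol red_le blue_le
    unfolding approx_solution_def solution_with_radii_def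
    by (simp add: covered_transformed Y_def[symmetric] Z_def[symmetric] del: of_nat_sum)
qed

section \<open>Verification of programs with a time bound\<close>

text \<open>The shift by one is the unit that \<open>bits\<close> charges for the sign.\<close>

lemma bits_le_iff: "bits x \<le> Suc k \<longleftrightarrow> \<bar>x\<bar> < 2 ^ k"
  using bitlen_le_iff_power[of "\<bar>x\<bar>" "int k"] by (auto simp: bits_def)

lemma bits_pos [simp]: "1 \<le> bits x" "0 < bits x"
  by (auto simp: bits_def)

lemma bits_mono: "\<bar>x\<bar> \<le> \<bar>y\<bar> \<Longrightarrow> bits x \<le> bits y"
  by (metis Suc_pred bits_le_iff bits_pos(2) le_less_trans order_refl)

lemma abs_less_bits: "\<bar>x\<bar> < 2 ^ (bits x - 1)"
  by (metis Suc_pred' bits_le_iff bits_pos(2) order_refl)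

text \<open>The carry is absorbed by one of the two sign units on the right.\<close>

lemma bits_add: "bits (x + y) \<le> bits x + bits y"
proof -
  obtain a b where ab: "bits x = Suc a" "bits y = Suc b" by (metis Suc_pred' bits_pos(2))
  then have *: "\<bar>x\<bar> < 2 ^ a" "\<bar>y\<bar> < 2 ^ b" using bits_le_iff by (metis order_refl)+
  have "(2::int) ^ a \<le> 2 ^ (a + b)" "(2::int) ^ b \<le> 2 ^ (a + b)" by (auto intro: power_increasing)
  then have "\<bar>x + y\<bar> < 2 ^ Suc (a + b)" using * unfolding power_Suc by linarith
  then show ?thesis using ab bits_le_iff[of "x + y" "Suc (a + b)"] by simp
qed

lemma bits_uminus [simp]: "bits (- x) = bits x"
  by (simp add: bits_def)

lemma bits_diff: "bits (x - y) \<le> bits x + bits y"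
  using bits_add[of x "- y"] by simp

lemma bits_mult: "bits (x * y) \<le> bits x + bits y"
proof -
  obtain a b where ab: "bits x = Suc a" "bits y = Suc b" by (metis Suc_pred' bits_pos(2))
  then have *: "\<bar>x\<bar> < 2 ^ a" "\<bar>y\<bar> < 2 ^ b" using bits_le_iff by (metis order_refl)+
  have "\<bar>x * y\<bar> < 2 ^ (a + b)"
    unfolding abs_mult power_add using * by (intro mult_strict_mono') auto
  then show ?thesis using ab bits_le_iff[of "x * y" "a + b"] by simp
qed

text \<open>The delicate case is a negative \<open>x\<close> with \<open>y > 0\<close>, where
  rounding goes away from zero. There \<open>x < y * (x div y + 1) \<le> x div y + 1\<close>,
  because \<open>x div y + 1\<close> is not positive. A negative divisor is handled by negating both
  arguments.\<close>

lemma abs_div_le: "\<bar>x div y\<bar> \<le> \<bar>x :: int\<bar>"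
proof -
  have pos: "\<bar>x div y\<bar> \<le> \<bar>x\<bar>" if "0 < y" for x y :: int
  proof (cases "0 \<le> x")
    case True
    have "0 \<le> x div y" using True that by (simp add: pos_imp_zdiv_nonneg_iff)
    moreover have "1 * (x div y) \<le> y * (x div y)" using that calculation by (intro mult_right_mono) auto
    moreover have "y * (x div y) \<le> x" using that by (simp add: minus_mod_eq_mult_div[symmetric])
    ultimately show ?thesis using True by simp
  next
    case False
    have q: "x div y < 0" using False that by (simp add: pos_imp_zdiv_neg_iff)
    have "x < y * (x div y + 1)"
      using mult_div_mod_eq[of y x] pos_mod_bound[OF that, of x] unfolding distrib_left by linarith
    also have "\<dots> \<le> 1 * (x div y + 1)" using that q by (intro mult_right_mono_neg) auto
    finally show ?thesis using q False by simp
  qed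
  show ?thesis using pos[of y x] pos[of "-y" "-x"] by (cases "y = 0"; cases "y > 0") auto
qed

lemma bits_div: "bits (x div y) \<le> bits x + bits y"
  using bits_mono[OF abs_div_le] trans_le_add1 by blast

section \<open>Cost bounds and a calculus of step counts\<close>

text \<open>The cost of an expression in units of \<open>bits M\<close>. Only memory cells are
  bounded by \<open>M\<close>, intermediate values may be larger: the length of a result is at most
  the lengths of both operands together, hence at most their costs, which gives the factor
  2.\<close>

fun asize :: "aexp \<Rightarrow> nat" where
  "asize (Const n) = bits n"
| "asize (Load A e) = asize e + 1"
| "asize (Add e f) = 2 * (asize e + asize f)"
| "asize (Sub e f) = 2 * (asize e + asize f)"
| "asize (Mul e f) = 2 * (asize e + asize f)"
| "asize (Div e f) = 2 * (asize e + asize f)"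

fun bsize :: "bexp \<Rightarrow> nat" where
  "bsize (Leq e f) = asize e + asize f + 1"
| "bsize (Not b) = bsize b + 1"
| "bsize (And b c) = bsize b + bsize c + 1"

fun csize :: "prog \<Rightarrow> nat" where
  "csize Skip = 1"
| "csize (Store A e f) = asize e + asize f + 1"
| "csize (Seq c d) = csize c + csize d"
| "csize (If b c d) = bsize b + csize c + csize d"
| "csize (While b c) = bsize b + csize c"

fun writes :: "prog \<Rightarrow> string set" where
  "writes Skip = {}"
| "writes (Store A e f) = {A}"
| "writes (Seq c d) = writes c \<union> writes d"
| "writes (If b c d) = writes c \<union> writes d"
| "writes (While b c) = writes c"

definition bounded :: "int \<Rightarrow> mem \<Rightarrow> bool" where
  "bounded M s \<longleftrightarrow> (\<forall>A i. \<bar>s A i\<bar> \<le> M)"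

lemma bits_aval_le_acost: "bits (aval e s) \<le> acost e s"
  by (cases e) auto

lemma acost_le:
  assumes "bounded M s"
  shows "acost e s \<le> asize e * bits M"
proof (induction e)
  case (Const n)
  then show ?case by (simp add: Suc_leI)
next
  case (Load A e)
  have "bits (aval (Load A e) s) \<le> bits M"
    using assms by (intro bits_mono) (auto simp: bounded_def intro: order_trans[OF _ abs_ge_self])
  then show ?case using Load by simp
next
  case (Add e f)
  then show ?case using bits_add[of "aval e s" "aval f s"] bits_aval_le_acost[of e s] bits_aval_le_acost[of f s]
    by (simp add: algebra_simps)
next
  case (Sub e f)
  then show ?case using bits_diff[of "aval e s" "aval f s"] bits_aval_le_acost[of e s] bits_aval_le_acost[of f s]
    by (simp add: algebra_simps)
next
  case (Mul e f)
  then show ?case using bits_mult[of "aval e s" "aval f s"] bits_aval_le_acost[of e s] bits_aval_le_acost[of f s]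
    by (simp add: algebra_simps)
next
  case (Div e f)
  then show ?case using bits_div[of "aval e s" "aval f s"] bits_aval_le_acost[of e s] bits_aval_le_acost[of f s]
    by (simp add: algebra_simps)
qed

lemma bcost_le:
  assumes "bounded M s"
  shows "bcost b s \<le> bsize b * bits M"
proof (induction b)
  case (Leq e f)
  then show ?case using acost_le[OF assms, of e] acost_le[OF assms, of f] bits_pos(1)[of M]
    by (simp add: algebra_simps del: bits_pos)
next
  case (Not b)
  then show ?case using bits_pos(1)[of M] by (simp add: algebra_simps del: bits_pos)
next
  case (And b c)
  then show ?case using bits_pos(1)[of M] by (simp add: algebra_simps del: bits_pos)
qed

text \<open>\<open>n\<close> counts elementary steps; \<open>csize c * bits M\<close> bounds the logarithmic cost of each of them as
  long as all memory cells stay below \<open>M\<close>.\<close>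

definition wp :: "int \<Rightarrow> prog \<Rightarrow> nat \<Rightarrow> (mem \<Rightarrow> bool) \<Rightarrow> mem \<Rightarrow> bool" where
  "wp M c n Q s \<longleftrightarrow> (bounded M s \<longrightarrow>
     (\<exists>t s'. exec c s t s' \<and> t \<le> n * (csize c * bits M) \<and> bounded M s' \<and> Q s'))"

lemma exec_frame: "exec c s t s' \<Longrightarrow> A \<notin> writes c \<Longrightarrow> s' A = s A"
  by (induction rule: exec.induct) auto

text \<open>Besides weakening, this hands over the frame condition, so specifications need to
  mention only the arrays that a program writes.\<close>

lemma wp_conseq:
  assumes "wp M c n Q s" "n \<le> m"
    and "\<And>s'. Q s' \<Longrightarrow> bounded M s' \<Longrightarrow> (\<And>A. A \<notin> writes c \<Longrightarrow> s' A = s A) \<Longrightarrow> Q' s'"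
  shows "wp M c m Q' s"
proof -
  have "n * (csize c * bits M) \<le> m * (csize c * bits M)" using assms(2) by simp
  then show ?thesis using assms(1,3) exec_frame unfolding wp_def by (meson order_trans)
qed

lemma wp_Skip: "Q s \<Longrightarrow> wp M Skip 1 Q s"
  using exec.Skip bits_pos(1)[of M] unfolding wp_def by fastforce

lemma wp_Store:
  assumes "\<bar>aval f s\<bar> \<le> M" "Q (s(A := (s A)(aval e s := aval f s)))"
  shows "wp M (Store A e f) 1 Q s"
proof -
  have "acost e s + acost f s + 1 \<le> csize (Store A e f) * bits M" if "bounded M s"
    using acost_le[OF that, of e] acost_le[OF that, of f] bits_pos(1)[of M]
    by (simp add: algebra_simps del: bits_pos)
  moreover have "bounded M (s(A := (s A)(aval e s := aval f s)))" if "bounded M s"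
    using that assms(1) by (auto simp: bounded_def)
  ultimately show ?thesis using exec.Store assms(2) unfolding wp_def by fastforce
qed

lemma wp_Seq:
  assumes "wp M c n (\<lambda>s'. wp M d m Q s') s"
  shows "wp M (Seq c d) (n + m) Q s"
  unfolding wp_def
proof
  assume "bounded M s"
  then obtain t s' where 1: "exec c s t s'" "t \<le> n * (csize c * bits M)" "bounded M s'" "wp M d m Q s'"
    using assms unfolding wp_def by blast
  then obtain u s'' where 2: "exec d s' u s''" "u \<le> m * (csize d * bits M)" "bounded M s''" "Q s''"
    unfolding wp_def by blast
  have "t + u \<le> n * (csize (Seq c d) * bits M) + m * (csize (Seq c d) * bits M)"
    using 1(2) 2(2) by (simp add: algebra_simps)
  then show "\<exists>t s'. exec (Seq c d) s t s' \<and> t \<le> (n + m) * (csize (Seq c d) * bits M) \<and> bounded M s' \<and> Q s'"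
    using exec.Seq[OF 1(1) 2(1)] 2(3,4) by (metis add_mult_distrib)
qed

lemma wp_If:
  assumes "bval b s \<Longrightarrow> wp M c n Q s" "\<not> bval b s \<Longrightarrow> wp M d n Q s"
  shows "wp M (If b c d) (n + 1) Q s"
  unfolding wp_def
proof
  assume bd: "bounded M s"
  define k where "k = csize (If b c d) * bits M"
  have b: "bcost b s \<le> k" using bcost_le[OF bd, of b] by (simp add: k_def algebra_simps)
  have c: "csize c * bits M \<le> k" "csize d * bits M \<le> k" by (auto simp: k_def)
  show "\<exists>t s'. exec (If b c d) s t s' \<and> t \<le> (n + 1) * (csize (If b c d) * bits M) \<and> bounded M s' \<and> Q s'"
  proof (cases "bval b s")
    case True
    then obtain t s' where 1: "exec c s t s'" "t \<le> n * (csize c * bits M)" "bounded M s'" "Q s'"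
      using assms(1) bd unfolding wp_def by blast
    then have "t \<le> n * k" using c by (meson mult_le_mono2 order_trans)
    then show ?thesis using exec.If_True[OF True 1(1)] 1 b unfolding k_def[symmetric]
      by (intro exI conjI) (auto simp: algebra_simps)
  next
    case False
    then obtain t s' where 1: "exec d s t s'" "t \<le> n * (csize d * bits M)" "bounded M s'" "Q s'"
      using assms(2) bd unfolding wp_def by blast
    then have "t \<le> n * k" using c by (meson mult_le_mono2 order_trans)
    then show ?thesis using exec.If_False[OF False 1(1)] 1 b unfolding k_def[symmetric]
      by (intro exI conjI) (auto simp: algebra_simps)
  qed
qed

lemma wp_While_False:
  assumes "\<not> bval b s" "Q s"
  shows "wp M (While b c) 1 Q s"
  using exec.While_False[of b s c] assms bcost_le[of M s b] unfolding wp_def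
  by (fastforce simp: algebra_simps intro: order_trans trans_le_add1)

lemma wp_While_True:
  assumes "bval b s" "wp M c n (\<lambda>s'. wp M (While b c) m Q s') s"
  shows "wp M (While b c) (n + m + 1) Q s"
  unfolding wp_def
proof
  assume bd: "bounded M s"
  define k where "k = csize (While b c) * bits M"
  obtain t s' where 1: "exec c s t s'" "t \<le> n * (csize c * bits M)" "bounded M s'" "wp M (While b c) m Q s'"
    using assms(2) bd unfolding wp_def by blast
  then obtain u s'' where 2: "exec (While b c) s' u s''" "u \<le> m * k" "bounded M s''" "Q s''"
    unfolding wp_def k_def by blast
  have "csize c * bits M \<le> k" by (simp add: k_def)
  then have "t \<le> n * k" using 1(2) by (meson mult_le_mono2 order_trans)
  moreover have "bcost b s \<le> k" using bcost_le[OF bd, of b] by (simp add: k_def algebra_simps)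
  ultimately have "bcost b s + t + u \<le> (n + m + 1) * k" using 2(2) by (simp add: algebra_simps)
  then show "\<exists>t s'. exec (While b c) s t s' \<and> t \<le> (n + m + 1) * (csize (While b c) * bits M) \<and> bounded M s' \<and> Q s'"
    using exec.While_True[OF assms(1) 1(1) 2(1)] 2(3,4) unfolding k_def by blast
qed

abbreviation V :: "string \<Rightarrow> aexp" where "V x \<equiv> Load x (Const 0)"
abbreviation Set :: "string \<Rightarrow> aexp \<Rightarrow> prog" where "Set x e \<equiv> Store x (Const 0) e"
abbreviation Less :: "aexp \<Rightarrow> aexp \<Rightarrow> bexp" where "Less e f \<equiv> Not (Leq f e)"

definition For :: "string \<Rightarrow> aexp \<Rightarrow> prog \<Rightarrow> prog" where
  "For i e c = Seq (Set i (Const 0)) (While (Less (V i) e) (Seq c (Set i (Add (V i) (Const 1)))))"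

lemma writes_For [simp]: "writes (For i e c) = insert i (writes c)"
  by (auto simp: For_def)

text \<open>Each round takes \<open>m\<close> steps plus the increment and the test; initialisation
  and the last test give the final 2. \<open>stable\<close> is needed because the increment follows
  the body, and \<open>bound\<close> keeps the limit fixed while the loop runs.\<close>

lemma wp_For:
  assumes bound: "\<And>s'. (\<And>A. A \<notin> insert i (writes c) \<Longrightarrow> s' A = s A) \<Longrightarrow> aval e s' = int N"
    and "int N \<le> M" and i: "i \<notin> writes c"
    and stable: "\<And>k s v. Inv k s \<Longrightarrow> Inv k (s(i := v))"
    and init: "Inv 0 s"
    and step: "\<And>k s'. \<lbrakk>k < N; Inv k s'; s' i 0 = int k; bounded M s';
        \<And>A. A \<notin> insert i (writes c) \<Longrightarrow> s' A = s A\<rbrakk> \<Longrightarrow> wp M c m (Inv (Suc k)) s'"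
    and post: "\<And>s'. \<lbrakk>Inv N s'; bounded M s'; \<And>A. A \<notin> insert i (writes c) \<Longrightarrow> s' A = s A\<rbrakk> \<Longrightarrow> Q s'"
  shows "wp M (For i e c) (N * (m + 2) + 2) Q s"
proof -
  let ?W = "While (Less (V i) e) (Seq c (Set i (Add (V i) (Const 1))))"
  have loop: "wp M ?W ((N - k) * (m + 2) + 1) Q s'"
    if "k \<le> N" "Inv k s'" "s' i 0 = int k" "\<And>A. A \<notin> insert i (writes c) \<Longrightarrow> s' A = s A" for k s'
    using that
  proof (induction "N - k" arbitrary: k s')
    case 0
    then have "k = N" by simp
    then have "wp M ?W 1 (\<lambda>s''. s'' = s') s'" using bound[of s'] 0 by (intro wp_While_False) auto
    then show ?case by (rule wp_conseq) (use 0 \<open>k = N\<close> post in auto)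
  next
    case (Suc d)
    have kN: "k < N" using Suc.hyps(2) by simp
    have d: "d = N - Suc k" using Suc.hyps(2) by simp
    have body: "wp M c m (\<lambda>s''. Inv (Suc k) s'' \<and> s'' i 0 = int k \<and> (\<forall>A. A \<notin> insert i (writes c) \<longrightarrow> s'' A = s A)) s'"
      if "bounded M s'"
      by (rule wp_conseq[OF step[OF kN Suc.prems(2,3) that Suc.prems(4)] order_refl]) (use i Suc.prems in auto)
    have "wp M ?W ((m + 1) + ((N - Suc k) * (m + 2) + 1) + 1) Q s'" if bd: "bounded M s'"
    proof (rule wp_While_True)
      show "bval (Less (V i) e) s'" using bound[of s'] Suc.prems kN by simp
      show "wp M (Seq c (Set i (Add (V i) (Const 1)))) (m + 1) (wp M ?W ((N - Suc k) * (m + 2) + 1) Q) s'"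
      proof (rule wp_Seq, rule wp_conseq[OF body[OF bd] order_refl], rule wp_Store)
        fix s'' assume *: "Inv (Suc k) s'' \<and> s'' i 0 = int k \<and> (\<forall>A. A \<notin> insert i (writes c) \<longrightarrow> s'' A = s A)"
        then show "\<bar>aval (Add (V i) (Const 1)) s''\<bar> \<le> M" using kN \<open>int N \<le> M\<close> by simp
        show "wp M ?W ((N - Suc k) * (m + 2) + 1) Q
          (s''(i := (s'' i)(aval (Const 0) s'' := aval (Add (V i) (Const 1)) s'')))"
          by (rule Suc.hyps(1)[OF d]) (use * kN stable in auto)
      qed
    qed
    moreover have "(m + 1) + ((N - Suc k) * (m + 2) + 1) + 1 = (N - k) * (m + 2) + 1"
    proof -
      have "N - k = Suc (N - Suc k)" using kN by simp
      then show ?thesis by simp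
    qed
    ultimately show ?case unfolding wp_def by metis
  qed
  have "wp M (For i e c) (1 + (N * (m + 2) + 1)) Q s"
    unfolding For_def
  proof (rule wp_Seq, rule wp_Store)
    show "\<bar>aval (Const 0) s\<bar> \<le> M" using \<open>int N \<le> M\<close> by simp
    show "wp M ?W (N * (m + 2) + 1) Q (s(i := (s i)(aval (Const 0) s := aval (Const 0) s)))"
      using loop[of 0 "s(i := (s i)(0 := 0))"] stable init by simp
  qed
  then show ?thesis by simp
qed

section \<open>The clustering program\<close>

lemma wp_If_Skip:
  assumes "bval b s \<Longrightarrow> wp M c n Q s" "\<not> bval b s \<Longrightarrow> Q s" "1 \<le> n"
  shows "wp M (If b c Skip) (n + 1) Q s"
  using assms wp_conseq[OF wp_Skip] by (intro wp_If) blast+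

abbreviation nE :: aexp where "nE \<equiv> Load ''in'' (Const 1)"

text \<open>Layout of \<open>in\<close>: the length in cell 0, \<open>n\<close> in cell 1, the
  matrix row by row from cell 2 with numerator and denominator in consecutive cells, then red
  weights, blue weights and parameters. \<open>paramsE 4\<close> and \<open>paramsE 6\<close>
  address the numerators of the two radii.\<close>

definition distE :: "aexp \<Rightarrow> aexp \<Rightarrow> aexp" where
  "distE e f = Add (Const 2) (Mul (Const 2) (Add (Mul e nE) f))"

definition weightsE :: aexp where
  "weightsE = Add (Const 2) (Mul (Const 2) (Mul nE nE))"

definition paramsE :: "int \<Rightarrow> aexp" where
  "paramsE k = Add (Add weightsE (Mul (Const 2) nE)) (Const k)"

text \<open>Two fractions are compared by cross-multiplication, which is exact as their denominators
  are positive.\<close>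

definition Near :: "int \<Rightarrow> aexp \<Rightarrow> aexp \<Rightarrow> bexp" where
  "Near k e f = Leq
     (Mul (Load ''in'' (distE e f)) (Load ''in'' (paramsE 7)))
     (Mul (Const k) (Mul (Load ''in'' (paramsE 6)) (Load ''in'' (Add (distE e f) (Const 1)))))"

definition redE :: "aexp \<Rightarrow> aexp" where
  "redE e = Load ''in'' (Add weightsE e)"

definition blueE :: "aexp \<Rightarrow> aexp" where
  "blueE e = Load ''in'' (Add weightsE (Add nE e))"

text \<open>Arrays: \<open>R\<close> and \<open>B\<close> hold the labels of the red and blue clusterings, \<open>S\<close> and \<open>T\<close> the weights of
  their clusters (both at the centre plus one), \<open>C\<close> the new red weights; the new blue weights are
  those in \<open>T\<close>.  The body of \<open>ArgMax\<close> leaves the value to be maximised in \<open>a\<close>; the maximiser ends up in \<open>b\<close>.\<close>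

definition ArgMax :: "string \<Rightarrow> prog \<Rightarrow> prog" where
  "ArgMax i c = Seq (Set ''m'' (Const (- 1))) (Seq (Set ''b'' (Const 0))
     (For i nE (Seq c (If (Less (V ''m'') (V ''a'')) (Seq (Set ''m'' (V ''a'')) (Set ''b'' (V i))) Skip))))"

definition BallWeight :: "string \<Rightarrow> (aexp \<Rightarrow> aexp) \<Rightarrow> prog" where
  "BallWeight L w = Seq (Set ''a'' (Const 0))
     (For ''x'' nE (If (And (Leq (Load L (V ''x'')) (Const 0)) (Near 1 (V ''p'') (V ''x'')))
       (Set ''a'' (Add (V ''a'') (w (V ''x'')))) Skip))"

definition Mark :: "string \<Rightarrow> prog" where
  "Mark L = For ''x'' nE (If (And (Leq (Load L (V ''x'')) (Const 0)) (Near 3 (V ''b'') (V ''x'')))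
     (Store L (V ''x'') (Add (V ''b'') (Const 1))) Skip)"

definition Greedy :: "string \<Rightarrow> (aexp \<Rightarrow> aexp) \<Rightarrow> prog" where
  "Greedy L w = For ''t'' nE (Seq (ArgMax ''p'' (BallWeight L w)) (Mark L))"

text \<open>Addressing \<open>W\<close> by the label itself sums all clusters in one pass; uncovered
  points fall into cell 0.\<close>

definition Tally :: "string \<Rightarrow> string \<Rightarrow> (aexp \<Rightarrow> aexp) \<Rightarrow> prog" where
  "Tally W L w = For ''x'' nE
     (Store W (Load L (V ''x'')) (Add (Load W (Load L (V ''x''))) (w (V ''x''))))"

text \<open>A point out of reach gets the value -1, below every weight and equal to the initial
  maximum of \<open>ArgMax\<close>, so it is never selected.\<close>

definition Favourite :: prog where
  "Favourite = For ''p'' nE (Seq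
     (ArgMax ''q'' (If (Near 8 (V ''p'') (V ''q'')) (Set ''a'' (Load ''T'' (Add (V ''q'') (Const 1)))) (Set ''a'' (Const (- 1)))))
     (Store ''C'' (V ''b'') (Add (Load ''C'' (V ''b'')) (Load ''S'' (Add (V ''p'') (Const 1))))))"

lemma writes_simps [simp]:
  "writes (ArgMax i c) = {''m'', ''b'', i} \<union> writes c"
  "writes (BallWeight L w) = {''a'', ''x''}"
  "writes (Mark L) = {''x'', L}"
  "writes (Greedy L w) = {''t'', ''p'', ''m'', ''b'', ''a'', ''x'', L}"
  "writes (Tally W L w) = {''x'', W}"
  "writes Favourite = {''p'', ''q'', ''m'', ''b'', ''a'', ''C''}"
  by (auto simp: ArgMax_def BallWeight_def Mark_def Greedy_def Tally_def Favourite_def)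

text \<open>\<open>0\<close> marks an uncovered point.\<close>

definition label_code :: "nat option \<Rightarrow> int" where
  "label_code l = (case l of None \<Rightarrow> 0 | Some c \<Rightarrow> int c + 1)"

lemma label_code_simps [simp]: "label_code l \<le> 0 \<longleftrightarrow> l = None" "label_code l = 1 + int c \<longleftrightarrow> l = Some c"
  "label_code l = int c + 1 \<longleftrightarrow> l = Some c" "label_code (Some c) = int c + 1"
  by (auto simp: label_code_def split: option.splits)

text \<open>What the clustering programs need to know about the array \<open>in\<close>, freed from
  the list encoding. \<open>M\<close> dominates the total weight of each colour because every
  accumulator is a partial sum of one colour.\<close>

locale instance_memory =
  fixes I :: "nat cnukc" and g :: "int \<Rightarrow> int" and N :: nat and M :: int
  assumes inst: "cnukc_instance I" and pts: "pts I = {..<N}"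
    and g_N: "g 1 = int N"
    and g_dist: "\<lbrakk>p < N; q < N\<rbrakk> \<Longrightarrow> 0 < g (2 + 2 * (int p * int N + int q) + 1) \<and>
      metr I p q = g (2 + 2 * (int p * int N + int q)) / g (2 + 2 * (int p * int N + int q) + 1)"
    and g_red: "x < N \<Longrightarrow> g (2 + 2 * (int N * int N) + int x) = int (red I x)"
    and g_blue: "x < N \<Longrightarrow> g (2 + 2 * (int N * int N) + (int N + int x)) = int (blue I x)"
    and g_rad2: "0 < g (2 + 2 * (int N * int N) + 2 * int N + 7)"
      "rad2 I = g (2 + 2 * (int N * int N) + 2 * int N + 6) / g (2 + 2 * (int N * int N) + 2 * int N + 7)"
    and M: "int N < M" "int (sum (red I) {..<N}) \<le> M" "int (sum (blue I) {..<N}) \<le> M"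
begin

lemma M_pos: "1 \<le> M" "0 < M" "0 \<le> M" using M(1) by auto

text \<open>Lets the colour-dependent programs be verified once for both colours.\<close>

definition weightE :: "(aexp \<Rightarrow> aexp) \<Rightarrow> (nat \<Rightarrow> nat) \<Rightarrow> bool" where
  "weightE w \<omega> \<longleftrightarrow> int (sum \<omega> {..<N}) \<le> M \<and>
     (\<forall>s e x. s ''in'' = g \<longrightarrow> aval e s = int x \<longrightarrow> x < N \<longrightarrow> aval (w e) s = int (\<omega> x))"

lemma weightE_red: "weightE redE (red I)"
  and weightE_blue: "weightE blueE (blue I)"
  using M g_red g_blue by (auto simp: weightE_def redE_def blueE_def weightsE_def g_N)

lemma weightE_sum:
  assumes "weightE w \<omega>" "A \<subseteq> {..<N}"
  shows "int (sum \<omega> A) \<le> M"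
proof -
  have "sum \<omega> A \<le> sum \<omega> {..<N}" using assms(2) by (intro sum_mono2) auto
  then show ?thesis using assms(1) unfolding weightE_def by linarith
qed

lemma bval_Near:
  assumes "s ''in'' = g" "aval e s = int p" "aval f s = int q" "p < N" "q < N"
  shows "bval (Near k e f) s \<longleftrightarrow> metr I p q \<le> k * rad2 I"
proof -
  define a b u v where "a = g (2 + 2 * (int p * int N + int q))"
    and "b = g (2 + 2 * (int p * int N + int q) + 1)"
    and "u = g (2 + 2 * (int N * int N) + 2 * int N + 6)"
    and "v = g (2 + 2 * (int N * int N) + 2 * int N + 7)"
  have pos: "0 < b" "0 < v" and eq: "metr I p q = a / b" "rad2 I = u / v"
    using g_dist[OF assms(4,5)] g_rad2 by (auto simp: a_def b_def u_def v_def)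
  have "bval (Near k e f) s \<longleftrightarrow> a * v \<le> k * (u * b)"
    using assms by (simp add: Near_def distE_def paramsE_def weightsE_def g_N a_def b_def u_def v_def)
  also have "\<dots> \<longleftrightarrow> real_of_int (a * v) \<le> real_of_int (k * (u * b))" by (simp only: of_int_le_iff)
  also have "\<dots> \<longleftrightarrow> metr I p q \<le> k * rad2 I"
    using pos by (simp add: eq field_simps)
  finally show ?thesis .
qed

lemma mem_near: "x \<in> near I k p \<longleftrightarrow> x < N \<and> metr I p x \<le> k * rad2 I"
  by (auto simp: near_def pts)

text \<open>The witness \<open>wit\<close> has a value above the initial maximum -1, so the search
  does select an index and \<open>b\<close> does not merely keep its initial 0.\<close>

lemma wp_ArgMax:
  assumes s: "s ''in'' = g" and i: "i \<notin> writes c" "i \<notin> {''in'', ''a'', ''m'', ''b''}"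
    and c: "''in'' \<notin> writes c" "''m'' \<notin> writes c" "''b'' \<notin> writes c"
    and f: "\<And>k. k < N \<Longrightarrow> - 1 \<le> f k \<and> f k \<le> M" and ex: "wit < N" "0 \<le> f wit"
    and body: "\<And>k s'. \<lbrakk>k < N; s' i 0 = int k; \<And>A. A \<notin> {i, ''m'', ''b''} \<union> writes c \<Longrightarrow> s' A = s A\<rbrakk>
      \<Longrightarrow> wp M c n (\<lambda>s''. s'' ''a'' 0 = f k) s'"
  shows "wp M (ArgMax i c) (N * (n + 5) + 4)
    (\<lambda>s'. \<exists>b<N. s' ''b'' 0 = int b \<and> (\<forall>k<N. f k \<le> f b)) s"
proof -
  have i': "''in'' \<noteq> i" "''m'' \<noteq> i" "''b'' \<noteq> i" using i by auto
  \<comment> \<open>Either nothing has exceeded the initial -1 yet, or \<open>b\<close> is a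
    maximiser among the indices seen.\<close>
  define Inv where "Inv = (\<lambda>k (s :: mem).
    (s ''m'' 0 = - 1 \<and> (\<forall>j<k. f j = - 1)) \<or>
    (\<exists>b<k. s ''b'' 0 = int b \<and> s ''m'' 0 = f b \<and> (\<forall>j<k. f j \<le> f b)))"
  let ?If = "If (Less (V ''m'') (V ''a'')) (Seq (Set ''m'' (V ''a'')) (Set ''b'' (V i))) Skip"
  let ?s = "(s(''m'' := (s ''m'')(0 := - 1)))(''b'' := ((s(''m'' := (s ''m'')(0 := - 1))) ''b'')(0 := 0))"
  have For: "wp M (For i nE (Seq c ?If)) (N * ((n + (1 + 1 + 1)) + 2) + 2)
    (\<lambda>s'. \<exists>b<N. s' ''b'' 0 = int b \<and> (\<forall>k<N. f k \<le> f b)) ?s"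
  proof (rule wp_For[where Inv = Inv])
    show "aval nE s' = int N" if "\<And>A. A \<notin> insert i (writes (Seq c ?If)) \<Longrightarrow> s' A = ?s A" for s'
      using that[of "''in''"] i' i c s by (simp add: g_N)
    show "i \<notin> writes (Seq c ?If)" using i by simp
    show "Inv k (s(i := v))" if "Inv k s" for k s v using that i' by (simp add: Inv_def)
    show "Inv 0 ?s" by (simp add: Inv_def)
    show "\<exists>b<N. s' ''b'' 0 = int b \<and> (\<forall>k<N. f k \<le> f b)" if "Inv N s'" for s'
      using that ex unfolding Inv_def by fastforce
  next
    fix k s' assume k: "k < N" "Inv k s'" "s' i 0 = int k"
      and fr: "\<And>A. A \<notin> insert i (writes (Seq c ?If)) \<Longrightarrow> s' A = ?s A"
    show "wp M (Seq c ?If) (n + (1 + 1 + 1)) (Inv (Suc k)) s'"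
    proof (rule wp_Seq, rule wp_conseq[OF body[of k s', OF k(1,3)] order_refl])
      show "s' A = s A" if "A \<notin> {i, ''m'', ''b''} \<union> writes c" for A using fr[of A] that by simp
    next
      fix s'' assume a: "s'' ''a'' 0 = f k" and fr': "\<And>A. A \<notin> writes c \<Longrightarrow> s'' A = s' A"
      have 1: "Inv k s''" "s'' i 0 = int k" using k(2,3) fr' i c by (auto simp: Inv_def)
      show "wp M ?If (1 + 1 + 1) (Inv (Suc k)) s''"
      proof (rule wp_If_Skip)
        assume b: "bval (Less (V ''m'') (V ''a'')) s''"
        show "wp M (Seq (Set ''m'' (V ''a'')) (Set ''b'' (V i))) (1 + 1) (Inv (Suc k)) s''"
        proof (rule wp_Seq, rule wp_Store, goal_cases)
          case 1
          then show ?case using a f[OF k(1)] M_pos by (auto simp: abs_le_iff)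
        next
          case 2
          show ?case
          proof (rule wp_Store, goal_cases)
            case 1
            then show ?case using i k(1) M by (simp add: \<open>s'' i 0 = int k\<close>)
          next
            case 2
            have "\<forall>j<Suc k. f j \<le> f k"
              using b a \<open>Inv k s''\<close> unfolding Inv_def by (auto simp: less_Suc_eq)
            then show ?case using i \<open>s'' i 0 = int k\<close> a by (auto simp: Inv_def)
          qed
        qed
      next
        assume b: "\<not> bval (Less (V ''m'') (V ''a'')) s''"
        show "Inv (Suc k) s''"
        proof (cases "s'' ''m'' 0 = - 1 \<and> (\<forall>j<k. f j = - 1)")
          case True
          then show ?thesis using b a f[OF k(1)] by (auto simp: Inv_def less_Suc_eq)
        next
          case False
          then obtain d where d: "d < k" "s'' ''b'' 0 = int d" "s'' ''m'' 0 = f d" "\<forall>j<k. f j \<le> f d"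
            using 1(1) unfolding Inv_def by blast
          then have "\<forall>j<Suc k. f j \<le> f d" using b a by (auto simp: less_Suc_eq)
          then show ?thesis unfolding Inv_def using d less_Suc_eq by blast
        qed
      qed simp
    qed
  qed (use M in auto)
  have "wp M (ArgMax i c) (1 + (1 + (N * ((n + (1 + 1 + 1)) + 2) + 2)))
    (\<lambda>s'. \<exists>b<N. s' ''b'' 0 = int b \<and> (\<forall>k<N. f k \<le> f b)) s"
    unfolding ArgMax_def
    by (intro wp_Seq wp_Store) (use For M_pos in simp_all)
  then show ?thesis by (simp add: eval_nat_numeral)
qed

lemma wp_BallWeight:
  assumes s: "s ''in'' = g" "s ''p'' 0 = int p" "p < N" and L: "L \<notin> {''in'', ''p'', ''x'', ''a''}"
    and w: "weightE w \<omega>"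
  shows "wp M (BallWeight L w) (N * 4 + 3)
    (\<lambda>s'. s' ''a'' 0 = int (sum \<omega> {x. x < N \<and> s L (int x) \<le> 0 \<and> x \<in> near I 1 p})) s"
proof -
  define A where "A k = {x. x < k \<and> s L (int x) \<le> 0 \<and> x \<in> near I 1 p}" for k :: nat
  define Inv where "Inv = (\<lambda>k (s' :: mem). s' ''a'' 0 = int (sum \<omega> (A k)))"
  have A: "A k \<subseteq> {..<N}" "finite (A k)" "k \<notin> A k" for k by (auto simp: A_def mem_near)
  have A_Suc: "A (Suc k) = (if s L (int k) \<le> 0 \<and> k \<in> near I 1 p then insert k (A k) else A k)" for k
    by (auto simp: A_def less_Suc_eq)
  let ?c = "If (And (Leq (Load L (V ''x'')) (Const 0)) (Near 1 (V ''p'') (V ''x'')))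
       (Set ''a'' (Add (V ''a'') (w (V ''x'')))) Skip"
  have "wp M (BallWeight L w) (1 + (N * ((1 + 1) + 2) + 2)) (\<lambda>s'. s' ''a'' 0 = int (sum \<omega> (A N))) s"
    unfolding BallWeight_def
  proof (rule wp_Seq, rule wp_Store)
    let ?s = "s(''a'' := (s ''a'')(aval (Const 0) s := aval (Const 0) s))"
    show "wp M (For ''x'' nE ?c) (N * ((1 + 1) + 2) + 2) (\<lambda>s'. s' ''a'' 0 = int (sum \<omega> (A N))) ?s"
    proof (rule wp_For[where Inv = Inv])
      fix k s' assume k: "k < N" "Inv k s'" "s' ''x'' 0 = int k"
        and fr: "\<And>B. B \<notin> insert ''x'' (writes ?c) \<Longrightarrow> s' B = ?s B"
      have s': "s' ''in'' = g" "s' ''p'' 0 = int p" "s' L = s L"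
        using fr[of "''in''"] fr[of "''p''"] fr[of L] s L by auto
      have nr: "bval (Near 1 (V ''p'') (V ''x'')) s' \<longleftrightarrow> k \<in> near I 1 p"
        using bval_Near[of s' "V ''p''" p "V ''x''" k 1] s' s(3) k by (simp add: mem_near)
      have w_k: "aval (w (V ''x'')) s' = int (\<omega> k)"
        using w s' k unfolding weightE_def by simp
      show "wp M ?c (1 + 1) (Inv (Suc k)) s'"
      proof (rule wp_If_Skip)
        assume b: "bval (And (Leq (Load L (V ''x'')) (Const 0)) (Near 1 (V ''p'') (V ''x''))) s'"
        then have "s L (int k) \<le> 0 \<and> k \<in> near I 1 p" using nr s' k by simp
        then have eq: "int (sum \<omega> (A (Suc k))) = int (sum \<omega> (A k)) + int (\<omega> k)"
          using A by (simp add: A_Suc)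
        show "wp M (Set ''a'' (Add (V ''a'') (w (V ''x'')))) 1 (Inv (Suc k)) s'"
        proof (rule wp_Store)
          show "\<bar>aval (Add (V ''a'') (w (V ''x''))) s'\<bar> \<le> M"
            using weightE_sum[OF w A(1)[of "Suc k"]] eq k(2) w_k by (simp add: Inv_def del: of_nat_sum)
        qed (use eq k(2) w_k in \<open>simp add: Inv_def\<close>)
      next
        assume "\<not> bval (And (Leq (Load L (V ''x'')) (Const 0)) (Near 1 (V ''p'') (V ''x''))) s'"
        then have "A (Suc k) = A k" using nr s' k by (auto simp: A_Suc)
        then show "Inv (Suc k) s'" using k(2) by (simp add: Inv_def)
      qed simp
    next
      show "aval nE s' = int N" if "\<And>A. A \<notin> insert ''x'' (writes ?c) \<Longrightarrow> s' A = ?s A" for s'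
        using that[of "''in''"] s by (simp add: g_N)
    qed (use M in \<open>auto simp: Inv_def A_def\<close>)
  qed (use M_pos in simp)
  then show ?thesis unfolding A_def by (rule wp_conseq) auto
qed

lemma wp_Mark:
  assumes s: "s ''in'' = g" "s ''b'' 0 = int b" "b < N" and L: "L \<notin> {''in'', ''b'', ''x''}"
  shows "wp M (Mark L) (N * 4 + 2)
    (\<lambda>s'. \<forall>x<N. s' L (int x) = (if s L (int x) \<le> 0 \<and> x \<in> near I 3 b then int b + 1 else s L (int x))) s"
proof -
  have L': "''in'' \<noteq> L" "''b'' \<noteq> L" "''x'' \<noteq> L" using L by auto
  define h where "h x = (if s L (int x) \<le> 0 \<and> x \<in> near I 3 b then int b + 1 else s L (int x))" for x
  define Inv where "Inv = (\<lambda>k (s' :: mem). \<forall>x<N. s' L (int x) = (if x < k then h x else s L (int x)))"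
  let ?c = "If (And (Leq (Load L (V ''x'')) (Const 0)) (Near 3 (V ''b'') (V ''x'')))
     (Store L (V ''x'') (Add (V ''b'') (Const 1))) Skip"
  have "wp M (Mark L) (N * ((1 + 1) + 2) + 2) (\<lambda>s'. \<forall>x<N. s' L (int x) = h x) s"
    unfolding Mark_def
  proof (rule wp_For[where Inv = Inv])
    fix k s' assume k: "k < N" "Inv k s'" "s' ''x'' 0 = int k"
      and fr: "\<And>B. B \<notin> insert ''x'' (writes ?c) \<Longrightarrow> s' B = s B"
    have s': "s' ''in'' = g" "s' ''b'' 0 = int b" "s' L (int k) = s L (int k)"
      using fr[of "''in''"] fr[of "''b''"] k(1,2) s L L' by (auto simp: Inv_def)
    have nr: "bval (Near 3 (V ''b'') (V ''x'')) s' \<longleftrightarrow> k \<in> near I 3 b"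
      using bval_Near[of s' "V ''b''" b "V ''x''" k 3] s' s(3) k by (simp add: mem_near)
    show "wp M ?c (1 + 1) (Inv (Suc k)) s'"
    proof (rule wp_If_Skip)
      assume b: "bval (And (Leq (Load L (V ''x'')) (Const 0)) (Near 3 (V ''b'') (V ''x''))) s'"
      then have h: "h k = int b + 1" using nr s' k by (simp add: h_def)
      show "wp M (Store L (V ''x'') (Add (V ''b'') (Const 1))) 1 (Inv (Suc k)) s'"
      proof (rule wp_Store)
        show "\<bar>aval (Add (V ''b'') (Const 1)) s'\<bar> \<le> M" using s' s(3) M by simp
      qed (use h k(2,3) s' in \<open>auto simp: Inv_def less_Suc_eq\<close>)
    next
      assume "\<not> bval (And (Leq (Load L (V ''x'')) (Const 0)) (Near 3 (V ''b'') (V ''x''))) s'"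
      then have "h k = s L (int k)" using nr s' k by (simp add: h_def)
      then show "Inv (Suc k) s'" using k(2) by (auto simp: Inv_def less_Suc_eq)
    qed simp
  next
    show "aval nE s' = int N" if "\<And>A. A \<notin> insert ''x'' (writes ?c) \<Longrightarrow> s' A = s A" for s'
      using that[of "''in''"] s L L' by (simp add: g_N)
  qed (use M L L' in \<open>auto simp: Inv_def\<close>)
  then show ?thesis unfolding h_def by (rule wp_conseq) auto
qed

text \<open>The list of centres is never stored. The invariant asserts that some greedy run of
  length \<open>k\<close> has the labels found in \<open>L\<close>; a round extends this run at its
  end.\<close>

lemma wp_Greedy:
  assumes s: "s ''in'' = g" "\<And>x. s L x = 0" and L: "L \<notin> {''in'', ''p'', ''x'', ''a'', ''m'', ''b'', ''t''}"
    and w: "weightE w \<omega>"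
  shows "wp M (Greedy L w) (N * ((N * ((N * 4 + 3) + 5) + 4) + (N * 4 + 2) + 2) + 2)
    (\<lambda>s'. \<exists>cs. greedy (near I 1) (near I 3) \<omega> (pts I) (pts I) cs \<and> length cs = card (pts I) \<and>
      (\<forall>x<N. s' L (int x) = label_code (label (near I 3) cs x))) s"
proof -
  have L': "''in'' \<noteq> L" "''t'' \<noteq> L" "''p'' \<noteq> L" "''m'' \<noteq> L" "''b'' \<noteq> L" using L by auto
  define Inv where "Inv = (\<lambda>k (s' :: mem). \<exists>cs. greedy (near I 1) (near I 3) \<omega> (pts I) (pts I) cs \<and>
    length cs = k \<and> (\<forall>x<N. s' L (int x) = label_code (label (near I 3) cs x)))"
  let ?c = "Seq (ArgMax ''p'' (BallWeight L w)) (Mark L)"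
  have "wp M (Greedy L w) (N * ((N * ((N * 4 + 3) + 5) + 4) + (N * 4 + 2) + 2) + 2) (Inv N) s"
    unfolding Greedy_def
  proof (rule wp_For[where Inv = Inv])
    fix k s' assume k: "k < N" "Inv k s'"
      and fr: "\<And>B. B \<notin> insert ''t'' (writes ?c) \<Longrightarrow> s' B = s B"
    obtain cs where cs: "greedy (near I 1) (near I 3) \<omega> (pts I) (pts I) cs" "length cs = k"
      "\<And>x. x < N \<Longrightarrow> s' L (int x) = label_code (label (near I 3) cs x)"
      using k(2) unfolding Inv_def by blast
    have in': "s' ''in'' = g" using fr[of "''in''"] s L L' by simp
    define U where "U = pts I - (\<Union>c\<in>set cs. near I 3 c)"
    \<comment> \<open>Cells holding 0 are exactly the uncovered points, so \<open>BallWeight\<close>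
      computes the quantity that the greedy rule maximises.\<close>
    have U: "{x. x < N \<and> s' L (int x) \<le> 0 \<and> x \<in> near I 1 p} = near I 1 p \<inter> U" for p
      using cs(3) by (auto simp: U_def label_None_iff pts mem_near)
    define f where "f p = int (sum \<omega> (near I 1 p \<inter> U))" for p
    show "wp M ?c ((N * ((N * 4 + 3) + 5) + 4) + (N * 4 + 2)) (Inv (Suc k)) s'"
    proof (rule wp_Seq, rule wp_conseq[OF wp_ArgMax[where f = f and wit = k] order_refl])
      show "- 1 \<le> f k \<and> f k \<le> M" for k
      proof -
        have "near I 1 k \<inter> U \<subseteq> {..<N}" by (auto simp: mem_near)
        from weightE_sum[OF w this] show ?thesis by (simp add: f_def del: of_nat_sum)
      qed
      show "wp M (BallWeight L w) (N * 4 + 3) (\<lambda>s'. s' ''a'' 0 = f p) s''"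
        if p: "p < N" "s'' ''p'' 0 = int p"
          and fr': "\<And>A. A \<notin> {''p'', ''m'', ''b''} \<union> writes (BallWeight L w) \<Longrightarrow> s'' A = s' A" for p s''
      proof -
        have "s'' ''in'' = g" "s'' L = s' L" using fr'[of "''in''"] fr'[of L] in' L L' by auto
        then show ?thesis using wp_BallWeight[of s'' p L w \<omega>] p w L U by (simp add: f_def)
      qed
    next
      fix s'' assume "\<exists>b<N. s'' ''b'' 0 = int b \<and> (\<forall>k<N. f k \<le> f b)"
        and fr': "\<And>A. A \<notin> writes (ArgMax ''p'' (BallWeight L w)) \<Longrightarrow> s'' A = s' A"
      then obtain b where b: "b < N" "s'' ''b'' 0 = int b" "\<And>k. k < N \<Longrightarrow> f k \<le> f b" by blast
      have s'': "s'' ''in'' = g" "s'' L = s' L" using fr'[of "''in''"] fr'[of L] in' L L' by auto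
      show "wp M (Mark L) (N * 4 + 2) (Inv (Suc k)) s''"
      proof (rule wp_conseq[OF wp_Mark[OF s''(1) b(2,1)] order_refl])
        fix t assume t: "\<forall>x<N. t L (int x) =
          (if s'' L (int x) \<le> 0 \<and> x \<in> near I 3 b then int b + 1 else s'' L (int x))"
        have "greedy (near I 1) (near I 3) \<omega> (pts I) (pts I) (cs @ [b])"
        proof -
          have "sum \<omega> (near I 1 p \<inter> U) \<le> sum \<omega> (near I 1 b \<inter> U)" if "p \<in> pts I" for p
            using b(3)[of p] that by (simp add: f_def pts del: of_nat_sum)
          then show ?thesis using cs(1) b(1) unfolding greedy_snoc U_def[symmetric] by (simp add: pts)
        qed
        moreover have "t L (int x) = label_code (label (near I 3) (cs @ [b]) x)" if "x < N" for x
          using t s''(2) cs(3) that by (simp add: label_snoc)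
        ultimately show "Inv (Suc k) t" using cs(2) unfolding Inv_def
          by (intro exI[of _ "cs @ [b]"]) simp
      qed (use L in auto)
    qed (use in' L L' k in \<open>auto simp: f_def simp del: of_nat_sum\<close>)
  next
    show "aval nE s' = int N" if "\<And>A. A \<notin> insert ''t'' (writes ?c) \<Longrightarrow> s' A = s A" for s'
      using that[of "''in''"] s L L' by (simp add: g_N)
    show "Inv 0 s" using s by (auto simp: Inv_def label_def label_code_def intro!: exI[of _ "[]"])
  qed (use M L L' in \<open>auto simp: Inv_def\<close>)
  then show ?thesis by (simp add: Inv_def pts)
qed

lemma wp_Tally:
  assumes s: "s ''in'' = g" "\<And>v. s W v = 0" and d: "L \<notin> {''in'', ''x'', W}" "W \<notin> {''in'', ''x''}"
    and w: "weightE w \<omega>"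
  shows "wp M (Tally W L w) (N * 3 + 2)
    (\<lambda>s'. \<forall>v. s' W v = int (sum \<omega> {x. x < N \<and> s L (int x) = v})) s"
proof -
  have d': "''in'' \<noteq> W" using d by auto
  define A where "A k v = {x. x < k \<and> s L (int x) = v}" for k :: nat and v
  define Inv where "Inv = (\<lambda>k (s' :: mem). \<forall>v. s' W v = int (sum \<omega> (A k v)))"
  have A: "k \<le> N \<Longrightarrow> A k v \<subseteq> {..<N}" "finite (A k v)" "k \<notin> A k v" for k v by (auto simp: A_def)
  have A_Suc: "A (Suc k) v = (if s L (int k) = v then insert k (A k v) else A k v)" for k v
    by (auto simp: A_def less_Suc_eq)
  let ?c = "Store W (Load L (V ''x'')) (Add (Load W (Load L (V ''x''))) (w (V ''x'')))"
  have "wp M (Tally W L w) (N * (1 + 2) + 2) (Inv N) s"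
    unfolding Tally_def
  proof (rule wp_For[where Inv = Inv])
    fix k s' assume k: "k < N" "Inv k s'" "s' ''x'' 0 = int k"
      and fr: "\<And>B. B \<notin> insert ''x'' (writes ?c) \<Longrightarrow> s' B = s B"
    have s': "s' ''in'' = g" "s' L = s L" using fr[of "''in''"] fr[of L] s d d' by auto
    have w_k: "aval (w (V ''x'')) s' = int (\<omega> k)"
      using w s' k unfolding weightE_def by simp
    have eq: "int (sum \<omega> (A (Suc k) (s L (int k)))) = s' W (s L (int k)) + int (\<omega> k)"
      using k(2) A by (simp add: A_Suc Inv_def)
    show "wp M ?c 1 (Inv (Suc k)) s'"
    proof (rule wp_Store)
      show "\<bar>aval (Add (Load W (Load L (V ''x''))) (w (V ''x''))) s'\<bar> \<le> M"
        using weightE_sum[OF w A(1)[of "Suc k" "s L (int k)"]] eq k s' w_k by (simp del: of_nat_sum)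
      show "Inv (Suc k) (s'(W := (s' W)(aval (Load L (V ''x'')) s' :=
        aval (Add (Load W (Load L (V ''x''))) (w (V ''x''))) s')))"
        using eq k(2,3) s' w_k by (simp add: Inv_def A_Suc)
    qed
  next
    show "aval nE s' = int N" if "\<And>A. A \<notin> insert ''x'' (writes ?c) \<Longrightarrow> s' A = s A" for s'
      using that[of "''in''"] s d d' by (simp add: g_N)
  qed (use M d s in \<open>auto simp: Inv_def A_def\<close>)
  then show ?thesis unfolding Inv_def A_def by (rule wp_conseq) auto
qed

text \<open>The map \<open>F\<close> exists only in the invariant, where each round extends it by
  \<open>F(k := b)\<close>; memory keeps just the red weight accumulated at each favourite.\<close>

lemma wp_Favourite:
  assumes s: "s ''in'' = g" "\<And>z. s ''C'' z = 0"
    and T: "\<And>j. j < N \<Longrightarrow> s ''T'' (int j + 1) = int (wb j)" "\<And>j. j < N \<Longrightarrow> int (wb j) \<le> M"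
    and S: "\<And>j. j < N \<Longrightarrow> s ''S'' (int j + 1) = int (wr j)" "int (sum wr {..<N}) \<le> M"
  shows "wp M Favourite (N * ((N * (2 + 5) + 4) + 1 + 2) + 2)
    (\<lambda>s'. \<exists>F. (\<forall>p<N. F p \<in> near I 8 p \<and> (\<forall>j\<in>near I 8 p. wb j \<le> wb (F p))) \<and>
      (\<forall>z<N. s' ''C'' (int z) = int (sum wr {p. p < N \<and> F p = z}))) s"
proof -
  define good where "good F p \<longleftrightarrow> F p \<in> near I 8 p \<and> (\<forall>j\<in>near I 8 p. wb j \<le> wb (F p))" for F p
  define Inv where "Inv = (\<lambda>k (s' :: mem). \<exists>F. (\<forall>p<k. good F p) \<and>
      (\<forall>z<N. s' ''C'' (int z) = int (sum wr {p. p < k \<and> F p = z})))"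
  let ?f = "If (Near 8 (V ''p'') (V ''q'')) (Set ''a'' (Load ''T'' (Add (V ''q'') (Const 1)))) (Set ''a'' (Const (- 1)))"
  let ?c = "Seq (ArgMax ''q'' ?f)
     (Store ''C'' (V ''b'') (Add (Load ''C'' (V ''b'')) (Load ''S'' (Add (V ''p'') (Const 1)))))"
  have "wp M Favourite (N * ((N * ((1 + 1) + 5) + 4) + 1 + 2) + 2) (Inv N) s"
    unfolding Favourite_def
  proof (rule wp_For[where Inv = Inv])
    fix k s' assume k: "k < N" "Inv k s'" "s' ''p'' 0 = int k"
      and fr: "\<And>B. B \<notin> insert ''p'' (writes ?c) \<Longrightarrow> s' B = s B"
    obtain F where F: "\<And>p. p < k \<Longrightarrow> good F p"
      "\<And>z. z < N \<Longrightarrow> s' ''C'' (int z) = int (sum wr {p. p < k \<and> F p = z})"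
      using k(2) unfolding Inv_def by blast
    have s': "s' ''in'' = g" "s' ''T'' = s ''T''" "s' ''S'' = s ''S''"
      using fr[of "''in''"] fr[of "''T''"] fr[of "''S''"] s by auto
    define f where "f j = (if j \<in> near I 8 k then int (wb j) else - 1)" for j
    \<comment> \<open>Every point is its own candidate, which supplies the witness for
      \<open>ArgMax\<close> and forces the chosen point to be in reach.\<close>
    have self: "k \<in> near I 8 k"
    proof -
      interpret Metric_space "pts I" "metr I" using inst by (simp add: cnukc_instance_def)
      show ?thesis using inst k(1) by (simp add: mem_near pts cnukc_instance_def)
    qed
    show "wp M ?c ((N * ((1 + 1) + 5) + 4) + 1) (Inv (Suc k)) s'"
    proof (rule wp_Seq, rule wp_conseq[OF wp_ArgMax[where f = f and wit = k] order_refl])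
      show "- 1 \<le> f j \<and> f j \<le> M" if "j < N" for j using T(2)[OF that] M_pos by (auto simp: f_def)
      show "0 \<le> f k" using self by (simp add: f_def)
      show "wp M ?f (1 + 1) (\<lambda>s'. s' ''a'' 0 = f j) s''"
        if j: "j < N" "s'' ''q'' 0 = int j" and fr': "\<And>A. A \<notin> {''q'', ''m'', ''b''} \<union> writes ?f \<Longrightarrow> s'' A = s' A" for j s''
      proof -
        have s'': "s'' ''in'' = g" "s'' ''T'' = s ''T''" "s'' ''p'' 0 = int k"
          using fr'[of "''in''"] fr'[of "''T''"] fr'[of "''p''"] s' k by auto
        have nr: "bval (Near 8 (V ''p'') (V ''q'')) s'' \<longleftrightarrow> j \<in> near I 8 k"
          using bval_Near[of s'' "V ''p''" k "V ''q''" j 8] s'' j k by (simp add: mem_near)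
        show ?thesis
          by (rule wp_If; rule wp_Store) (use nr s'' j T M_pos in \<open>auto simp: f_def\<close>)
      qed
    next
      fix s'' assume "\<exists>b<N. s'' ''b'' 0 = int b \<and> (\<forall>j<N. f j \<le> f b)"
        and fr': "\<And>A. A \<notin> writes (ArgMax ''q'' ?f) \<Longrightarrow> s'' A = s' A"
      then obtain b where b: "b < N" "s'' ''b'' 0 = int b" "\<And>j. j < N \<Longrightarrow> f j \<le> f b" by blast
      have s'': "s'' ''S'' = s ''S''" "s'' ''C'' = s' ''C''" "s'' ''p'' 0 = int k"
        using fr'[of "''S''"] fr'[of "''C''"] fr'[of "''p''"] s' k by auto
      define F' where "F' = F(k := b)"
      have bk: "b \<in> near I 8 k" using b(3)[OF k(1)] self by (auto simp: f_def split: if_splits)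
      then have "good F' k" using b(3) by (fastforce simp: good_def F'_def f_def mem_near)
      then have good: "\<And>p. p < Suc k \<Longrightarrow> good F' p" using F(1) by (auto simp: good_def F'_def less_Suc_eq)
      have set: "{p. p < Suc k \<and> F' p = z} = (if z = b then insert k {p. p < k \<and> F p = z} else {p. p < k \<and> F p = z})" for z
        by (auto simp: F'_def less_Suc_eq)
      have sum: "int (sum wr {p. p < Suc k \<and> F' p = z}) =
          int (sum wr {p. p < k \<and> F p = z}) + (if z = b then int (wr k) else 0)" for z
        by (simp add: set)
      have le: "int (sum wr {p. p < Suc k \<and> F' p = b}) \<le> M"
      proof -
        have "sum wr {p. p < Suc k \<and> F' p = b} \<le> sum wr {..<N}" using k(1) by (intro sum_mono2) auto
        then show ?thesis using S(2) by linarith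
      qed
      show "wp M (Store ''C'' (V ''b'') (Add (Load ''C'' (V ''b'')) (Load ''S'' (Add (V ''p'') (Const 1))))) 1 (Inv (Suc k)) s''"
      proof (rule wp_Store)
        show "\<bar>aval (Add (Load ''C'' (V ''b'')) (Load ''S'' (Add (V ''p'') (Const 1)))) s''\<bar> \<le> M"
          using le sum[of b] s'' b F(2) S(1) k(1) by (simp del: of_nat_sum)
        show "Inv (Suc k) (s''(''C'' := (s'' ''C'')(aval (V ''b'') s'' :=
            aval (Add (Load ''C'' (V ''b'')) (Load ''S'' (Add (V ''p'') (Const 1)))) s'')))"
          unfolding Inv_def
          by (intro exI[of _ F']) (use good sum s'' b F(2) S(1) k(1) in \<open>simp del: of_nat_sum\<close>)
      qed
    qed (use s' k in auto)
  next
    show "aval nE s' = int N" if "\<And>A. A \<notin> insert ''p'' (writes ?c) \<Longrightarrow> s' A = s A" for s'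
      using that[of "''in''"] s by (simp add: g_N)
    show "Inv k (s(''p'' := v))" if "Inv k s" for k s v using that by (simp add: Inv_def)
  qed (use M s in \<open>auto simp: Inv_def\<close>)
  then show ?thesis unfolding Inv_def good_def by (rule wp_conseq) auto
qed

end

section \<open>The output program\<close>

definition Copy :: "aexp \<Rightarrow> aexp \<Rightarrow> prog" where
  "Copy len off = Seq
     (For ''x'' len (Store ''out'' (Add (V ''x'') (Const 1)) (Load ''in'' (Add (V ''x'') (Add off (Const 1))))))
     (Set ''out'' len)"

definition PutWeights :: prog where
  "PutWeights = For ''x'' nE (Seq
     (Store ''out'' (Add weightsE (V ''x'')) (Load ''C'' (V ''x'')))
     (Store ''out'' (Add weightsE (Add nE (V ''x''))) (Load ''T'' (Add (V ''x'') (Const 1)))))"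

text \<open>Euclid's algorithm, with the remainder written as
  \<open>u - (u div v) * v\<close>.\<close>

definition GcdLoop :: prog where
  "GcdLoop = While (Leq (Const 1) (V ''v''))
     (Seq (Set ''w'' (Sub (V ''u'') (Mul (Div (V ''u'') (V ''v'')) (V ''v''))))
     (Seq (Set ''u'' (V ''v'')) (Set ''v'' (V ''w''))))"

text \<open>Starting Euclid's loop from the pair \<open>(d + e, e)\<close> makes the first component dominate the second.\<close>

definition PutRadii :: prog where
  "PutRadii =
     Seq (Set ''e'' (Mul (Load ''in'' (paramsE 5)) (Load ''in'' (paramsE 7))))
    (Seq (Set ''d'' (Add (Mul (Load ''in'' (paramsE 4)) (Load ''in'' (paramsE 7)))
       (Mul (Const 26) (Mul (Load ''in'' (paramsE 6)) (Load ''in'' (paramsE 5))))))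
    (Seq (Set ''u'' (Add (V ''d'') (V ''e'')))
    (Seq (Set ''v'' (V ''e''))
    (Seq GcdLoop
    (Seq (Store ''out'' (paramsE 4) (Div (V ''d'') (V ''u'')))
    (Seq (Store ''out'' (paramsE 5) (Div (V ''e'') (V ''u'')))
    (Seq (Store ''out'' (paramsE 6) (Const 0))
         (Store ''out'' (paramsE 7) (Const 1)))))))))"

text \<open>Only weights and radii change and a rational always takes two entries, so the whole
  input is copied first and the changed entries are overwritten in place.\<close>

definition Transform :: prog where
  "Transform =
     Seq (Greedy ''R'' redE)
    (Seq (Greedy ''B'' blueE)
    (Seq (Tally ''S'' ''R'' redE)
    (Seq (Tally ''T'' ''B'' blueE)
    (Seq Favourite
    (Seq (Copy (Load ''in'' (Const 0)) (Const 0))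
    (Seq PutWeights PutRadii))))))"

lemma writes_put [simp]:
  "writes (Copy len off) = {''x'', ''out''}"
  "writes PutWeights = {''x'', ''out''}"
  "writes GcdLoop = {''u'', ''v'', ''w''}"
  by (auto simp: Copy_def PutWeights_def GcdLoop_def)

lemma wp_Copy:
  assumes len: "\<And>s'. s' ''in'' = s ''in'' \<Longrightarrow> aval len s' = int l" "int l \<le> M"
    and off: "\<And>s'. s' ''in'' = s ''in'' \<Longrightarrow> aval off s' = k"
  shows "wp M (Copy len off) (l * 3 + 3)
    (\<lambda>s'. s' ''out'' 0 = int l \<and> (\<forall>i<l. s' ''out'' (1 + int i) = s ''in'' (1 + k + int i))) s"
proof -
  let ?c = "Store ''out'' (Add (V ''x'') (Const 1)) (Load ''in'' (Add (V ''x'') (Add off (Const 1))))"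
  let ?Q = "\<lambda>s'. s' ''out'' 0 = int l \<and> (\<forall>i<l. s' ''out'' (1 + int i) = s ''in'' (1 + k + int i))"
  define Inv where "Inv = (\<lambda>j (s' :: mem). \<forall>i<j. s' ''out'' (1 + int i) = s ''in'' (1 + k + int i))"
  have "wp M (For ''x'' len ?c) (l * (1 + 2) + 2) (wp M (Set ''out'' len) 1 ?Q) s"
  proof (rule wp_For[where Inv = Inv])
    show "aval len s' = int l" if "\<And>A. A \<notin> insert ''x'' (writes ?c) \<Longrightarrow> s' A = s A" for s'
      using that[of "''in''"] len by simp
    show "Inv 0 s" "\<And>k s v. Inv k s \<Longrightarrow> Inv k (s(''x'' := v))" by (auto simp: Inv_def)
  next
    fix j s' assume j: "j < l" "Inv j s'" "s' ''x'' 0 = int j" and bd: "bounded M s'"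
      and fr: "\<And>B. B \<notin> insert ''x'' (writes ?c) \<Longrightarrow> s' B = s B"
    have s': "s' ''in'' = s ''in''" using fr[of "''in''"] by simp
    show "wp M ?c 1 (Inv (Suc j)) s'"
    proof -
      have "\<bar>s ''in'' i\<bar> \<le> M" for i using bd s' by (metis bounded_def)
      then show ?thesis
        by (intro wp_Store) (use j s' off[of s'] in \<open>auto simp: Inv_def less_Suc_eq algebra_simps\<close>)
    qed
  next
    fix s' assume j: "Inv l s'" and fr: "\<And>B. B \<notin> insert ''x'' (writes ?c) \<Longrightarrow> s' B = s B"
    have s': "s' ''in'' = s ''in''" using fr[of "''in''"] by simp
    show "wp M (Set ''out'' len) 1 ?Q s'"
      by (rule wp_Store) (use len s' j in \<open>auto simp: Inv_def\<close>)
  qed (use len in auto)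
  then show ?thesis unfolding Copy_def by (intro wp_conseq[OF wp_Seq, of M _ "l * (1 + 2) + 2" _ 1]) auto
qed

lemma wp_PutWeights:
  assumes s: "s ''in'' = g" "g 1 = int N" and "int N \<le> M"
  shows "wp M PutWeights (N * 4 + 2)
    (\<lambda>s'. \<forall>i. s' ''out'' i = (let b = 2 + 2 * (int N * int N) in
       if b \<le> i \<and> i < b + int N then s ''C'' (i - b)
       else if b + int N \<le> i \<and> i < b + 2 * int N then s ''T'' (i - b - int N + 1)
       else s ''out'' i)) s"
proof -
  define b where "b = 2 + 2 * (int N * int N)"
  \<comment> \<open>The shift by one in \<open>T\<close> but not in \<open>C\<close>: cluster
    weights sit at the centre plus one, shipped red weight at the favourite itself.\<close>
  define h where "h k i = (if b \<le> i \<and> i < b + int k then s ''C'' (i - b)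
       else if b + int N \<le> i \<and> i < b + int N + int k then s ''T'' (i - b - int N + 1)
       else s ''out'' i)" for k i
  define Inv where "Inv = (\<lambda>k (s' :: mem). \<forall>i. s' ''out'' i = h k i)"
  let ?c = "Seq (Store ''out'' (Add weightsE (V ''x'')) (Load ''C'' (V ''x'')))
     (Store ''out'' (Add weightsE (Add nE (V ''x''))) (Load ''T'' (Add (V ''x'') (Const 1))))"
  have "wp M PutWeights (N * ((1 + 1) + 2) + 2) (Inv N) s"
    unfolding PutWeights_def
  proof (rule wp_For[where Inv = Inv])
    show "aval nE s' = int N" if "\<And>A. A \<notin> insert ''x'' (writes ?c) \<Longrightarrow> s' A = s A" for s'
      using that[of "''in''"] s by simp
    show "Inv 0 s" "\<And>k s v. Inv k s \<Longrightarrow> Inv k (s(''x'' := v))" by (auto simp: Inv_def h_def)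
  next
    fix k s' assume k: "k < N" "Inv k s'" "s' ''x'' 0 = int k" and bd: "bounded M s'"
      and fr: "\<And>B. B \<notin> insert ''x'' (writes ?c) \<Longrightarrow> s' B = s B"
    have s': "s' ''in'' = g" "s' ''C'' = s ''C''" "s' ''T'' = s ''T''"
      using fr[of "''in''"] fr[of "''C''"] fr[of "''T''"] s by auto
    have h: "h (Suc k) = (h k)(b + int k := s ''C'' (int k), b + (int N + int k) := s ''T'' (int k + 1))"
      using k(1) by (auto simp: h_def fun_eq_iff)
    have bd': "\<bar>s ''T'' i\<bar> \<le> M" for i using bd s' by (metis bounded_def)
    show "wp M ?c (1 + 1) (Inv (Suc k)) s'"
    proof (rule wp_Seq, rule wp_Store, goal_cases)
      case 1
      then show ?case using bd by (simp add: bounded_def)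
    next
      case 2
      show ?case
        by (rule wp_Store)
          (use bd' s' k(2,3) s(2) in \<open>simp_all add: Inv_def h weightsE_def flip: b_def\<close>)
    qed
  qed (use \<open>int N \<le> M\<close> in auto)
  then show ?thesis
    by (rule wp_conseq) (auto simp: Inv_def h_def b_def Let_def)
qed

text \<open>The product of the pair is the potential: \<open>b \<le> a\<close> gives
  \<open>2 * (a mod b) \<le> a\<close>, so \<open>b * (a mod b)\<close> is at most half of
  \<open>a * b\<close>. A round costs three assignments and a test.\<close>

lemma wp_GcdLoop:
  assumes "s ''u'' 0 = a" "s ''v'' 0 = b" "0 \<le> b" "b \<le> a" "a \<le> M" "a * b < 2 ^ k"
  shows "wp M GcdLoop (4 * k + 1) (\<lambda>s'. s' ''u'' 0 = gcd a b) s"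
  using assms
proof (induction k arbitrary: a b s)
  case 0
  then have "b = 0" by (smt (verit) mult_pos_pos power_0)
  then show ?case unfolding GcdLoop_def
    using 0 by (intro wp_conseq[OF wp_While_False[where Q = "\<lambda>s'. s' ''u'' 0 = gcd a b"]]) auto
next
  case (Suc k)
  show ?case
  proof (cases "b = 0")
    case True
    then show ?thesis unfolding GcdLoop_def
      using Suc.prems by (intro wp_conseq[OF wp_While_False[where Q = "\<lambda>s'. s' ''u'' 0 = gcd a b"]]) auto
  next
    case False
    then have b: "0 < b" using Suc.prems by simp
    have r: "0 \<le> a mod b" "a mod b < b" using b by auto
    have "2 * (a mod b) \<le> a"
    proof -
      have "1 \<le> a div b" using b Suc.prems(4) by (simp add: pos_imp_zdiv_pos_iff int_one_le_iff_zero_less)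
      then have "1 * b \<le> (a div b) * b" using b by (intro mult_right_mono) auto
      then show ?thesis using r div_mult_mod_eq[of a b] by linarith
    qed
    then have "b * (2 * (a mod b)) \<le> b * a" using b by (intro mult_left_mono) auto
    then have prod: "b * (a mod b) < 2 ^ k" using Suc.prems(6) by (simp add: mult.commute)
    have gcd: "gcd b (a mod b) = gcd a b" using gcd_red_int[of a b] by simp
    have w: "a - a div b * b = a mod b" by (simp add: minus_div_mult_eq_mod)
    have IH: "wp M GcdLoop (4 * k + 1) (\<lambda>s'. s' ''u'' 0 = gcd a b) s'"
      if "s' ''u'' 0 = b" "s' ''v'' 0 = a mod b" for s'
      by (rule Suc.IH[where s = s' and a = b and b = "a mod b", OF that r(1) less_imp_le[OF r(2)] _ prod, unfolded gcd])
        (use Suc.prems in linarith)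
    have "wp M GcdLoop ((1 + (1 + 1)) + (4 * k + 1) + 1) (\<lambda>s'. s' ''u'' 0 = gcd a b) s"
      unfolding GcdLoop_def
    proof (rule wp_While_True, goal_cases)
      case 1
      then show ?case using b Suc.prems by simp
    next
      case 2
      show ?case
        unfolding GcdLoop_def[symmetric]
      proof (intro wp_Seq wp_Store, goal_cases)
        case 4
        show ?case by (rule IH) (use Suc.prems in \<open>simp_all add: w\<close>)
      qed (use Suc.prems b r in \<open>simp_all add: w\<close>)
    qed
    then show ?thesis by (rule wp_conseq) auto
  qed
qed

text \<open>The encoding demands lowest terms, hence the gcd; adding \<open>D\<close> to the first
  argument leaves it unchanged. Four assignments, the loop and four stores make
  \<open>4 * k + 9\<close>.\<close>

lemma wp_PutRadii:
  assumes s: "s ''in'' = g" "g 1 = int N"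
    and c: "c = 2 + 2 * (int N * int N) + 2 * int N"
    and pos: "0 \<le> g (c + 4)" "0 < g (c + 5)" "0 \<le> g (c + 6)" "0 < g (c + 7)"
    and A: "A = g (c + 4) * g (c + 7) + 26 * (g (c + 6) * g (c + 5))" and D: "D = g (c + 5) * g (c + 7)"
    and M: "A + D \<le> M" and k: "(A + D) * D < 2 ^ k"
  shows "wp M PutRadii (4 * k + 9)
    (\<lambda>s'. s' ''out'' = (s ''out'')(c + 4 := A div gcd A D, c + 5 := D div gcd A D, c + 6 := 0, c + 7 := 1)) s"
proof -
  have AD: "0 \<le> A" "0 < D" using pos by (auto simp: A D)
  have div: "0 \<le> A div gcd A D" "A div gcd A D \<le> A" "0 \<le> D div gcd A D" "D div gcd A D \<le> D"
    using abs_div_le[of A "gcd A D"] abs_div_le[of D "gcd A D"] AD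
    by (auto simp: pos_imp_zdiv_nonneg_iff)
  let ?t = "Seq (Store ''out'' (paramsE 4) (Div (V ''d'') (V ''u'')))
    (Seq (Store ''out'' (paramsE 5) (Div (V ''e'') (V ''u'')))
    (Seq (Store ''out'' (paramsE 6) (Const 0)) (Store ''out'' (paramsE 7) (Const 1))))"
  let ?Q = "\<lambda>s'. s' ''out'' = (s ''out'')(c + 4 := A div gcd A D, c + 5 := D div gcd A D, c + 6 := 0, c + 7 := 1)"
  have tail: "wp M ?t (1 + (1 + (1 + 1))) ?Q s'"
    if "s' ''u'' 0 = gcd A D" "s' ''d'' 0 = A" "s' ''e'' 0 = D" "s' ''in'' = g" "s' ''out'' = s ''out''" for s'
    by (intro wp_Seq wp_Store)
      (use that s div AD M in \<open>simp_all add: paramsE_def weightsE_def flip: c\<close>)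
  have "wp M PutRadii (1 + (1 + (1 + (1 + ((4 * k + 1) + (1 + (1 + (1 + 1)))))))) ?Q s"
    unfolding PutRadii_def
  proof (intro wp_Seq wp_Store, goal_cases)
    case 1
    then show ?case using s AD M by (simp add: paramsE_def weightsE_def flip: c D)
  next
    case 2
    then show ?case using s AD M by (simp add: paramsE_def weightsE_def flip: c A)
  next
    case 3
    then show ?case using s AD M by (simp add: paramsE_def weightsE_def flip: c A D)
  next
    case 4
    then show ?case using s AD M by (simp add: paramsE_def weightsE_def flip: c A D)
  next
    case 5
    show ?case
    proof (rule wp_conseq[OF wp_GcdLoop[where a = "A + D" and b = D and k = k] order_refl], goal_cases)
      case (7 s')
      show ?case
        by (rule tail) (use 7 s in \<open>simp_all add: paramsE_def weightsE_def flip: c A D\<close>)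
    qed (use s AD M k in \<open>simp_all add: paramsE_def weightsE_def flip: c A D\<close>)
  qed
  then show ?thesis by (rule wp_conseq) auto
qed

section \<open>Correctness of the transformation\<close>

text \<open>One predicate for both directions: it decodes the input array and certifies the output
  array.\<close>

definition stored :: "(int \<Rightarrow> int) \<Rightarrow> int \<Rightarrow> int list \<Rightarrow> bool" where
  "stored g k xs \<longleftrightarrow> (\<forall>i<length xs. g (k + int i) = xs ! i)"

lemma stored_Nil [simp]: "stored g k []"
  by (simp add: stored_def)

lemma stored_Cons [simp]: "stored g k (x # xs) \<longleftrightarrow> g k = x \<and> stored g (k + 1) xs"
  unfolding stored_def length_Cons All_less_Suc2 by (simp add: algebra_simps)

lemma stored_append: "stored g k (xs @ ys) \<longleftrightarrow> stored g k xs \<and> stored g (k + int (length xs)) ys"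
  by (induction xs arbitrary: k) (auto simp: algebra_simps)

lemma stored_map_upt: "stored g k (map f [0..<n]) \<longleftrightarrow> (\<forall>i<n. g (k + int i) = f i)"
  by (auto simp: stored_def)

lemma length_concat_map_upt:
  assumes "\<And>i. i < n \<Longrightarrow> length (f i) = m"
  shows "length (concat (map f [0..<n])) = n * m"
  using assms by (induction n) auto

lemma stored_concat_map_upt:
  assumes "\<And>i. i < n \<Longrightarrow> length (f i) = m"
  shows "stored g k (concat (map f [0..<n])) \<longleftrightarrow> (\<forall>i<n. stored g (k + int (i * m)) (f i))"
  using assms
proof (induction n)
  case (Suc n)
  then show ?case using length_concat_map_upt[of n f m]
    by (auto simp: stored_append less_Suc_eq)
qed simp

lemma stored_init_mem: "stored (init_mem xs ''in'') 1 xs" "init_mem xs ''in'' 0 = int (length xs)"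
  by (auto simp: stored_def init_mem_def nat_add_distrib)

lemma out_list_stored:
  assumes "s ''out'' 0 = int (length xs)" "stored (s ''out'') 1 xs"
  shows "out_list s = xs"
  using assms by (intro nth_equalityI) (auto simp: out_list_def stored_def)

lemma enc_rat_of_rat: "enc_rat (real_of_rat q) = [fst (quotient_of q), snd (quotient_of q)]"
proof -
  have "(THE q'. of_rat q' = real_of_rat q) = q" by (rule the_equality) auto
  then show ?thesis by (simp add: enc_rat_def case_prod_beta)
qed

lemma enc_rat_Rats:
  assumes "x \<in> \<rat>"
  obtains a b where "enc_rat x = [a, b]" "0 < b" "x = a / b"
proof -
  obtain q where q: "x = of_rat q" using assms Rats_cases by blast
  obtain a b where ab: "quotient_of q = (a, b)" by fastforce
  then have "x = a / b" using quotient_of_div[OF ab] by (simp add: q of_rat_divide)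
  then show ?thesis using that[of a b] enc_rat_of_rat[of q] quotient_of_denom_pos[OF ab] ab q by simp
qed

lemma length_enc_rat [simp]: "length (enc_rat x) = 2"
  by (simp add: enc_rat_def case_prod_beta)

lemma enc_rat_divide:
  assumes "0 < D"
  shows "enc_rat (A / D) = [A div gcd A D, D div gcd A D]"
proof -
  have "A / D = real_of_rat (Fract A D)" using assms by (simp add: Fract_of_int_quotient of_rat_divide)
  then have "enc_rat (A / D) = [fst (quotient_of (Fract A D)), snd (quotient_of (Fract A D))]"
    using enc_rat_of_rat by metis
  then show ?thesis using assms by (simp add: quotient_of_Fract Rat.normalize_def Let_def)
qed

definition row_stored :: "(int \<Rightarrow> int) \<Rightarrow> nat cnukc \<Rightarrow> nat \<Rightarrow> bool" where
  "row_stored g I n \<longleftrightarrow>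
     (\<forall>p<n. \<forall>q<n. stored g (2 + 2 * (int p * int n + int q)) (enc_rat (metr I p q)))"

lemma length_enc_instance: "length (enc_instance I) = 2 * (card (pts I) * card (pts I)) + 2 * card (pts I) + 9"
  by (simp add: enc_instance_def Let_def length_concat_map_upt[where m = "2 * card (pts I)"]
      length_concat_map_upt[where m = 2])

text \<open>The address map of an encoded instance. As an equivalence it serves both to read the
  given instance and to recognise the transformed one.\<close>

lemma stored_enc_instance:
  assumes "n = card (pts I)" "b = 2 + 2 * (int n * int n)"
  shows "stored g 1 (enc_instance I) \<longleftrightarrow>
    g 1 = int n \<and> row_stored g I n \<and>
    (\<forall>x<n. g (b + int x) = int (red I x)) \<and>
    (\<forall>x<n. g (b + (int n + int x)) = int (blue I x)) \<and>
    stored g (b + 2 * int n) [m_red I, m_blue I, int (k1 I), int (k2 I)] \<and>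
    stored g (b + 2 * int n + 4) (enc_rat (rad1 I)) \<and>
    stored g (b + 2 * int n + 6) (enc_rat (rad2 I))"
proof -
  have row: "length (concat (map (\<lambda>q. enc_rat (metr I p q)) [0..<n])) = n * 2" for p
    by (intro length_concat_map_upt) simp
  have matrix: "length (concat (map (\<lambda>p. concat (map (\<lambda>q. enc_rat (metr I p q)) [0..<n])) [0..<n])) = n * (n * 2)"
    by (intro length_concat_map_upt row)
  have "stored g 2 (concat (map (\<lambda>p. concat (map (\<lambda>q. enc_rat (metr I p q)) [0..<n])) [0..<n])) \<longleftrightarrow>
      row_stored g I n"
    by (simp add: stored_concat_map_upt[where m = "n * 2", OF row] stored_concat_map_upt[where m = 2]
        row_stored_def algebra_simps)
  moreover have "2 + int (n * (n * 2)) = b" by (simp add: assms(2))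
  ultimately show ?thesis
    unfolding enc_instance_def Let_def assms(1)[symmetric] stored_append
    by (simp add: matrix stored_map_upt algebra_simps)
qed

lemma row_stored_cong:
  assumes "row_stored g I n" "metr J = metr I" "\<And>i. \<lbrakk>2 \<le> i; i < 2 + 2 * (int n * int n)\<rbrakk> \<Longrightarrow> h i = g i"
  shows "row_stored h J n"
  unfolding row_stored_def
proof (intro allI impI)
  fix p q assume pq: "p < n" "q < n"
  \<comment> \<open>Both cells of the entry for \<open>p\<close> and \<open>q\<close> must lie below
    \<open>2 + 2 * (n * n)\<close>, where the assumption on \<open>h\<close> ends.\<close>
  have "Suc p * n \<le> n * n" using pq(1) by (intro mult_right_mono) auto
  then have "p * n + q < n * n" using pq(2) by simp
  then have le: "int p * int n + int q + 1 \<le> int n * int n"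
    by (metis add.commute of_nat_Suc of_nat_add of_nat_le_iff of_nat_mult plus_1_eq_Suc Suc_leI)
  have "stored g (2 + 2 * (int p * int n + int q)) (enc_rat (metr I p q))"
    using assms(1) pq by (simp add: row_stored_def)
  then show "stored h (2 + 2 * (int p * int n + int q)) (enc_rat (metr J p q))"
    using le unfolding stored_def assms(2) by (auto simp: less_Suc_eq numeral_2_eq_2 intro!: trans[OF assms(3)])
qed

section \<open>Size bounds and the composed program\<close>

text \<open>Each summand is at most \<open>2 ^ (bits x - 1)\<close>, and the sign unit provides the
  factor 2 that absorbs adding it to the rest. Bounds on the length, the entries and the sum of
  absolute values all follow.\<close>

lemma abs_sum_le_input_size: "(\<Sum>x\<leftarrow>xs. \<bar>x\<bar> + 1) \<le> 2 ^ input_size xs"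
proof (induction xs)
  case (Cons x xs)
  obtain b where b: "bits x = Suc b" by (metis Suc_pred' bits_pos(2))
  have 1: "\<bar>x\<bar> + 1 \<le> 2 ^ b" using abs_less_bits[of x] b by simp
  have 2: "(2::int) ^ b \<le> 2 ^ (b + input_size xs)" "(2::int) ^ input_size xs \<le> 2 ^ (b + input_size xs)"
    by (auto intro: power_increasing)
  have "(\<Sum>x\<leftarrow>x # xs. \<bar>x\<bar> + 1) \<le> 2 * 2 ^ (b + input_size xs)"
    unfolding list.map sum_list.Cons using Cons 1 2 by linarith
  also have "2 * 2 ^ (b + input_size xs) = (2::int) ^ input_size (x # xs)" by (simp add: input_size_def b)
  finally show ?case .
qed (simp add: input_size_def)

lemma length_le_input_size: "length xs \<le> input_size xs"
proof (induction xs)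
  case (Cons x xs)
  then show ?case using bits_pos(2)[of x] by (simp add: input_size_def del: bits_pos)
qed simp

lemma length_le_power: "int (length xs) \<le> 2 ^ input_size xs"
proof -
  have "int (length xs) \<le> (\<Sum>x\<leftarrow>xs. \<bar>x\<bar> + 1)" by (induction xs) auto
  then show ?thesis using abs_sum_le_input_size by (rule order_trans)
qed

lemma abs_le_power:
  assumes "x \<in> set xs"
  shows "\<bar>x\<bar> \<le> 2 ^ input_size xs"
proof -
  have "\<bar>x\<bar> + 1 \<le> (\<Sum>x\<leftarrow>xs. \<bar>x\<bar> + 1)"
    using assms by (intro member_le_sum_list) auto
  then show ?thesis using abs_sum_le_input_size[of xs] by linarith
qed

lemma sum_list_abs_le_power: "sum_list (map abs xs) \<le> 2 ^ input_size xs"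
  using abs_sum_le_input_size[of xs] by (simp add: sum_list_addf sum_list_triv)

text \<open>The largest numbers written are sums of products of two input entries in
  \<open>PutRadii\<close>, at most \<open>28 * (W * W)\<close> for
  \<open>W = 2 ^ input_size xs\<close>. The factor 100 is below \<open>2 ^ 7\<close>, so the bit
  length stays linear.\<close>

definition value_bound :: "int list \<Rightarrow> int" where
  "value_bound xs = 100 * 4 ^ input_size xs"

lemma bits_value_bound: "bits (value_bound xs) \<le> 2 * input_size xs + 8"
proof -
  have "(4::int) ^ input_size xs = 2 ^ (2 * input_size xs)" by (simp add: power_mult)
  then have "\<bar>value_bound xs\<bar> < 2 ^ (2 * input_size xs + 7)" by (simp add: value_bound_def power_add)
  then show ?thesis using bits_le_iff[of "value_bound xs" "2 * input_size xs + 7"] by simp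
qed

lemma power_le_value_bound: "2 ^ input_size xs < value_bound xs"
proof -
  have "(2::int) ^ input_size xs \<le> 4 ^ input_size xs" by (intro power_mono) auto
  moreover have "(4::int) ^ input_size xs < 100 * 4 ^ input_size xs" by simp
  ultimately show ?thesis unfolding value_bound_def by linarith
qed

lemma bounded_init_mem: "bounded (value_bound xs) (init_mem xs)"
proof -
  have "\<bar>init_mem xs A i\<bar> \<le> 2 ^ input_size xs" for A i
  proof -
    have "init_mem xs A i \<in> insert 0 (insert (int (length xs)) (set xs))"
    proof (cases "nat i")
      case (Suc j)
      then have "(int (length xs) # xs) ! nat i \<in> set xs" if "i \<le> int (length xs)" using that by auto
      then show ?thesis by (simp add: init_mem_def)
    qed (auto simp: init_mem_def)
    then show ?thesis using abs_le_power[of _ xs] length_le_power[of xs] by auto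
  qed
  then show ?thesis unfolding bounded_def using power_le_value_bound[of xs] by (meson le_less_trans less_imp_le)
qed

lemma exec_wp:
  assumes "wp (value_bound xs) c n Q (init_mem xs)"
  shows "\<exists>t s. exec c (init_mem xs) t s \<and> t \<le> n * (csize c * (2 * input_size xs + 8)) \<and> Q s"
proof -
  obtain t s where ts: "exec c (init_mem xs) t s" "t \<le> n * (csize c * bits (value_bound xs))" "Q s"
    using assms bounded_init_mem unfolding wp_def by blast
  have "n * (csize c * bits (value_bound xs)) \<le> n * (csize c * (2 * input_size xs + 8))"
    using bits_value_bound by (intro mult_left_mono) auto
  then show ?thesis using ts order_trans by blast
qed

definition greedy_steps :: "nat \<Rightarrow> nat" where
  "greedy_steps n = n * ((n * ((n * 4 + 3) + 5) + 4) + (n * 4 + 2) + 2) + 2"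

definition favourite_steps :: "nat \<Rightarrow> nat" where
  "favourite_steps n = n * ((n * (2 + 5) + 4) + 1 + 2) + 2"

text \<open>One summand per stage of \<open>Transform\<close>, in its order. \<open>l\<close> is the
  length of the input list; \<open>z\<close>, its bit size, enters through Euclid's loop.\<close>

definition transform_steps :: "nat \<Rightarrow> nat \<Rightarrow> nat \<Rightarrow> nat" where
  "transform_steps n l z = greedy_steps n + (greedy_steps n + ((n * 3 + 2) + ((n * 3 + 2) + (favourite_steps n +
      ((l * 3 + 3) + ((n * 4 + 2) + (4 * (4 * z + 5) + 9)))))))"

lemma transform_steps_mono:
  assumes "n \<le> z" "l \<le> z"
  shows "transform_steps n l z \<le> transform_steps z z z"
  unfolding transform_steps_def greedy_steps_def favourite_steps_def
  by (intro add_mono mult_mono assms order_refl) auto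

abbreviation (input) transformed :: "'a cnukc \<Rightarrow> ('a \<Rightarrow> nat) \<Rightarrow> ('a \<Rightarrow> nat) \<Rightarrow> 'a cnukc" where
  "transformed I \<chi>r \<chi>b \<equiv> I\<lparr>red := \<chi>r, blue := \<chi>b, rad1 := rad1 I + 26 * rad2 I, rad2 := 0\<rparr>"

lemma wp_Transform:
  assumes inst: "cnukc_instance I" and enc: "encodable I"
  shows "wp (value_bound (enc_instance I)) Transform
      (let z = input_size (enc_instance I) in transform_steps z z z)
    (\<lambda>s. \<exists>\<chi>r \<chi>b. reduction I \<chi>r \<chi>b \<and> out_list s = enc_instance (transformed I \<chi>r \<chi>b))
    (init_mem (enc_instance I))"
proof -
  define n where "n = card (pts I)"
  define b where "b = 2 + 2 * (int n * int n)"
  define c where "c = b + 2 * int n"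
  define xs where "xs = enc_instance I"
  define z where "z = input_size xs"
  define M where "M = value_bound xs"
  define s0 where "s0 = init_mem xs"
  define g where "g = s0 ''in''"
  have pts: "pts I = {..<n}" using enc by (simp add: encodable_def n_def)
  have rats: "metr I p q \<in> \<rat>" if "p < n" "q < n" for p q using enc that pts by (auto simp: encodable_def)
  have g0: "g 0 = int (length xs)" and st: "stored g 1 xs"
    using stored_init_mem by (auto simp: g_def s0_def)
  have len: "length xs = 2 * (n * n) + 2 * n + 9" by (simp add: xs_def n_def length_enc_instance)
  note lay = st[unfolded xs_def stored_enc_instance[OF n_def b_def], folded c_def]
  obtain a1 b1 where r1: "enc_rat (rad1 I) = [a1, b1]" "0 < b1" "rad1 I = a1 / b1"
    using enc_rat_Rats enc unfolding encodable_def by metis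
  obtain a2 b2 where r2: "enc_rat (rad2 I) = [a2, b2]" "0 < b2" "rad2 I = a2 / b2"
    using enc_rat_Rats enc unfolding encodable_def by metis
  have g_rads: "g (c + 4) = a1" "g (c + 5) = b1" "g (c + 6) = a2" "g (c + 7) = b2"
  proof -
    have "stored g (c + 4) [a1, b1]" "stored g (c + 6) [a2, b2]" using lay r1 r2 by auto
    then show "g (c + 4) = a1" "g (c + 5) = b1" "g (c + 6) = a2" "g (c + 7) = b2"
      by (simp_all add: algebra_simps)
  qed
  have nn: "0 \<le> a1" "0 \<le> a2"
  proof -
    have "0 \<le> rad2 I" "0 \<le> rad1 I" using inst by (auto simp: cnukc_instance_def)
    then show "0 \<le> a1" "0 \<le> a2" using r1 r2 by (auto simp: zero_le_divide_iff)
  qed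
  define W where "W = (2::int) ^ z"
  have W: "1 \<le> W" "W < M" "28 * (W * W) \<le> M" "\<And>x. x \<in> set xs \<Longrightarrow> \<bar>x\<bar> \<le> W" "int (length xs) \<le> W"
      "sum_list (map abs xs) \<le> W"
    using power_le_value_bound[of xs] abs_le_power[of _ xs] length_le_power[of xs] sum_list_abs_le_power[of xs]
    by (auto simp: W_def M_def z_def value_bound_def simp flip: power_mult_distrib)
  have rad_mem: "{a1, b1, a2, b2} \<subseteq> set xs"
    using r1 r2 by (auto simp: xs_def enc_instance_def Let_def)
  then have rad_le: "a1 \<le> W" "b1 \<le> W" "a2 \<le> W" "b2 \<le> W"
    using W(4) by (auto dest!: spec simp: abs_le_iff subset_iff)
  define A D where "A = a1 * b2 + 26 * (a2 * b1)" and "D = b1 * b2"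
  have AD: "0 \<le> A" "0 < D" "A \<le> 27 * (W * W)" "D \<le> W * W"
  proof -
    have "a1 * b2 \<le> W * W" "a2 * b1 \<le> W * W" "b1 * b2 \<le> W * W"
      using rad_le nn r1(2) r2(2) W(1) by (auto intro!: mult_mono)
    then show "A \<le> 27 * (W * W)" "D \<le> W * W" by (auto simp: A_def D_def)
    show "0 \<le> A" "0 < D" using nn r1(2) r2(2) by (auto simp: A_def D_def)
  qed
  \<comment> \<open>The potential of Euclid's loop at its start: at most \<open>28 * W ^ 4\<close>,
    and 28 < 32 = \<open>2 ^ 5\<close>.\<close>
  have prod: "(A + D) * D < 2 ^ (4 * z + 5)"
  proof -
    have "(A + D) * D \<le> (28 * (W * W)) * (W * W)" using AD by (intro mult_mono) auto
    also have "\<dots> < 32 * (W * W * (W * W))" using W(1) by simp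
    also have "\<dots> = 2 ^ (4 * z + 5)" by (simp add: W_def power_add power_mult flip: power_mult_distrib)
    finally show ?thesis .
  qed
  have rad: "enc_rat (rad1 I + 26 * rad2 I) = [A div gcd A D, D div gcd A D]"
  proof -
    have "rad1 I + 26 * rad2 I = real_of_int A / real_of_int D"
      unfolding r1(3) r2(3) A_def D_def using r1(2) r2(2) by (simp add: field_simps)
    then show ?thesis using enc_rat_divide[OF AD(2)] by simp
  qed
  have c_eq: "c = 2 + 2 * (int n * int n) + 2 * int n" by (simp add: c_def b_def)
  have g_nn: "0 \<le> g (c + 4)" "0 < g (c + 5)" "0 \<le> g (c + 6)" "0 < g (c + 7)"
    using nn r1 r2 by (simp_all add: g_rads)
  have A_eq: "A = g (c + 4) * g (c + 7) + 26 * (g (c + 6) * g (c + 5))" and D_eq: "D = g (c + 5) * g (c + 7)"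
    by (simp_all add: g_rads A_def D_def)
  have AD_le: "A + D \<le> M" using AD(3,4) W(3) by linarith
  \<comment> \<open>The weights of each colour form a segment of the input list, so their total is
    part of the sum of all absolute values.\<close>
  have sums: "int (sum (red I) {..<n}) \<le> W" "int (sum (blue I) {..<n}) \<le> W"
  proof -
    have eq: "sum_list (map abs (map (\<lambda>p. int (w p)) [0..<n])) = int (sum w {..<n})" for w :: "nat \<Rightarrow> nat"
      by (simp add: o_def interv_sum_list_conv_sum_set_nat atLeast0LessThan)
    have nonneg: "0 \<le> sum_list (map abs ys)" for ys :: "int list" by (intro sum_list_nonneg) auto
    obtain ys us where xs: "xs = ys @ map (\<lambda>p. int (red I p)) [0..<n] @ map (\<lambda>p. int (blue I p)) [0..<n] @ us"
      unfolding xs_def enc_instance_def Let_def n_def[symmetric] by (metis append.assoc)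
    show "int (sum (red I) {..<n}) \<le> W" "int (sum (blue I) {..<n}) \<le> W"
      using W(6) nonneg[of ys] nonneg[of us] unfolding xs map_append sum_list_append eq by linarith+
  qed
  have nL: "int n < int (length xs)" unfolding len of_nat_less_iff by simp
  interpret instance_memory I g n M
  proof
    show "0 < g (2 + 2 * (int p * int n + int q) + 1) \<and>
      metr I p q = g (2 + 2 * (int p * int n + int q)) / g (2 + 2 * (int p * int n + int q) + 1)"
      if pq: "p < n" "q < n" for p q
    proof -
      obtain u v where "enc_rat (metr I p q) = [u, v]" "0 < v" "metr I p q = u / v"
        using enc_rat_Rats[OF rats[OF pq]] by metis
      moreover have "stored g (2 + 2 * (int p * int n + int q)) (enc_rat (metr I p q))"
        using lay pq by (simp add: row_stored_def)
      ultimately show ?thesis by simp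
    qed
  qed (use inst pts lay g_rads r2 sums W nL in \<open>auto simp: b_def c_def simp del: of_nat_sum\<close>)
  \<comment> \<open>\<open>Greedy\<close>, \<open>Tally\<close> and \<open>Favourite\<close> rely on
    their result arrays being 0 at the start; the frame conditions carry this along.\<close>
  have zero: "s0 X = (\<lambda>_. 0)" if "X \<noteq> ''in''" for X using that by (auto simp: s0_def init_mem_def)
  have in0: "s0 ''in'' = g" by (simp add: g_def)
  define post where "post s \<longleftrightarrow> (\<exists>\<chi>r \<chi>b. reduction I \<chi>r \<chi>b \<and> out_list s = enc_instance (transformed I \<chi>r \<chi>b))" for s
  have "wp M Transform (transform_steps n (length xs) z) post s0"
    unfolding Transform_def transform_steps_def
  proof (rule wp_Seq, rule wp_conseq[OF wp_Greedy[OF _ _ _ weightE_red, folded greedy_steps_def] order_refl])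
    fix s1 assume "\<exists>cs. greedy (near I 1) (near I 3) (red I) (pts I) (pts I) cs \<and> length cs = card (pts I) \<and>
        (\<forall>x<n. s1 ''R'' (int x) = label_code (label (near I 3) cs x))"
      and "\<And>X. X \<notin> writes (Greedy ''R'' redE) \<Longrightarrow> s1 X = s0 X"
    then obtain cs where cs: "greedy (near I 1) (near I 3) (red I) (pts I) (pts I) cs" "length cs = card (pts I)"
      and R: "\<And>x. x < n \<Longrightarrow> s1 ''R'' (int x) = label_code (label (near I 3) cs x)"
      and fr1: "s1 ''in'' = g" "s1 ''B'' = (\<lambda>_. 0)" "s1 ''S'' = (\<lambda>_. 0)" "s1 ''T'' = (\<lambda>_. 0)" "s1 ''C'' = (\<lambda>_. 0)"
      using in0 zero by auto
    show "wp M (Seq (Greedy ''B'' blueE) (Seq (Tally ''S'' ''R'' redE) (Seq (Tally ''T'' ''B'' blueE)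
        (Seq Favourite (Seq (Copy (Load ''in'' (Const 0)) (Const 0)) (Seq PutWeights PutRadii))))))
      (greedy_steps n + ((n * 3 + 2) + ((n * 3 + 2) + (favourite_steps n +
      ((length xs * 3 + 3) + ((n * 4 + 2) + (4 * (4 * z + 5) + 9))))))) post s1"
    proof (rule wp_Seq, rule wp_conseq[OF wp_Greedy[OF _ _ _ weightE_blue, folded greedy_steps_def] order_refl])
      fix s2 assume "\<exists>cs. greedy (near I 1) (near I 3) (blue I) (pts I) (pts I) cs \<and> length cs = card (pts I) \<and>
          (\<forall>x<n. s2 ''B'' (int x) = label_code (label (near I 3) cs x))"
        and "\<And>X. X \<notin> writes (Greedy ''B'' blueE) \<Longrightarrow> s2 X = s1 X"
      then obtain bs where bs: "greedy (near I 1) (near I 3) (blue I) (pts I) (pts I) bs" "length bs = card (pts I)"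
        and B: "\<And>x. x < n \<Longrightarrow> s2 ''B'' (int x) = label_code (label (near I 3) bs x)"
        and fr2: "s2 ''in'' = g" "s2 ''R'' = s1 ''R''" "s2 ''S'' = (\<lambda>_. 0)" "s2 ''T'' = (\<lambda>_. 0)" "s2 ''C'' = (\<lambda>_. 0)"
        using fr1 by auto
      show "wp M (Seq (Tally ''S'' ''R'' redE) (Seq (Tally ''T'' ''B'' blueE)
          (Seq Favourite (Seq (Copy (Load ''in'' (Const 0)) (Const 0)) (Seq PutWeights PutRadii)))))
        ((n * 3 + 2) + ((n * 3 + 2) + (favourite_steps n +
        ((length xs * 3 + 3) + ((n * 4 + 2) + (4 * (4 * z + 5) + 9)))))) post s2"
      proof (rule wp_Seq, rule wp_conseq[OF wp_Tally[OF _ _ _ _ weightE_red] order_refl])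
        fix s3 assume S: "\<forall>v. s3 ''S'' v = int (sum (red I) {x. x < n \<and> s2 ''R'' (int x) = v})"
          and "\<And>X. X \<notin> writes (Tally ''S'' ''R'' redE) \<Longrightarrow> s3 X = s2 X"
        then have fr3: "s3 ''in'' = g" "s3 ''B'' = s2 ''B''" "s3 ''T'' = (\<lambda>_. 0)" "s3 ''C'' = (\<lambda>_. 0)"
          using fr2 by auto
        show "wp M (Seq (Tally ''T'' ''B'' blueE)
            (Seq Favourite (Seq (Copy (Load ''in'' (Const 0)) (Const 0)) (Seq PutWeights PutRadii))))
          ((n * 3 + 2) + (favourite_steps n +
          ((length xs * 3 + 3) + ((n * 4 + 2) + (4 * (4 * z + 5) + 9))))) post s3"
        proof (rule wp_Seq, rule wp_conseq[OF wp_Tally[OF _ _ _ _ weightE_blue] order_refl])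
          fix s4 assume T: "\<forall>v. s4 ''T'' v = int (sum (blue I) {x. x < n \<and> s3 ''B'' (int x) = v})"
            and "\<And>X. X \<notin> writes (Tally ''T'' ''B'' blueE) \<Longrightarrow> s4 X = s3 X"
          then have fr4: "s4 ''in'' = g" "s4 ''S'' = s3 ''S''" "s4 ''C'' = (\<lambda>_. 0)" using fr3 by auto
          define wr wb where "wr = cluster_weight I (red I) cs" and "wb = cluster_weight I (blue I) bs"
          have wr: "s4 ''S'' (int p + 1) = int (wr p)" and wb: "s4 ''T'' (int p + 1) = int (wb p)" for p
          proof -
            have "{x. x < n \<and> s2 ''R'' (int x) = int p + 1} = {x \<in> pts I. label (near I 3) cs x = Some p}"
              using R fr2 by (auto simp: pts)
            then show "s4 ''S'' (int p + 1) = int (wr p)" using S fr4 by (simp add: wr_def cluster_weight_def)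
            have "{x. x < n \<and> s3 ''B'' (int x) = int p + 1} = {x \<in> pts I. label (near I 3) bs x = Some p}"
              using B fr3 by (auto simp: pts)
            then show "s4 ''T'' (int p + 1) = int (wb p)" using T by (simp add: wb_def cluster_weight_def)
          qed
          have wb_le: "int (wb p) \<le> M" for p
            unfolding wb_def cluster_weight_def by (rule weightE_sum[OF weightE_blue]) (auto simp: pts)
          have wr_le: "int (sum wr {..<n}) \<le> M"
          proof -
            have "sum wr {..<n} = sum (red I) {x \<in> pts I. label (near I 3) cs x \<in> Some ` {..<n}}"
              unfolding wr_def by (rule cluster_weight_sum) (auto simp: pts)
            then show ?thesis using weightE_sum[OF weightE_red, of "{x \<in> pts I. label (near I 3) cs x \<in> Some ` {..<n}}"]
              by (simp add: pts subset_iff del: of_nat_sum)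
          qed
          show "wp M (Seq Favourite (Seq (Copy (Load ''in'' (Const 0)) (Const 0)) (Seq PutWeights PutRadii)))
            (favourite_steps n +
            ((length xs * 3 + 3) + ((n * 4 + 2) + (4 * (4 * z + 5) + 9)))) post s4"
          proof (rule wp_Seq, rule wp_conseq[OF wp_Favourite[OF fr4(1) _ wb wb_le wr wr_le, folded favourite_steps_def] order_refl])
            fix s5 assume "\<exists>F. (\<forall>p<n. F p \<in> near I 8 p \<and> (\<forall>j\<in>near I 8 p. wb j \<le> wb (F p))) \<and>
                (\<forall>z<n. s5 ''C'' (int z) = int (sum wr {p. p < n \<and> F p = z}))"
              and "\<And>X. X \<notin> writes Favourite \<Longrightarrow> s5 X = s4 X"
            then obtain F where F: "\<And>p. p < n \<Longrightarrow> F p \<in> near I 8 p \<and> (\<forall>j\<in>near I 8 p. wb j \<le> wb (F p))"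
                and C: "\<And>z. z < n \<Longrightarrow> s5 ''C'' (int z) = int (sum wr {p. p < n \<and> F p = z})"
                and fr5: "s5 ''in'' = g" "s5 ''T'' = s4 ''T''" using fr4 by auto
            define \<chi>r where "\<chi>r z = sum wr {p. p < n \<and> F p = z}" for z
            have red: "reduction I \<chi>r wb"
              unfolding reduction_def
              by (intro exI[of _ cs] exI[of _ bs] exI[of _ F])
                (use cs bs F in \<open>auto simp: pts \<chi>r_def wr_def wb_def\<close>)
            show "wp M (Seq (Copy (Load ''in'' (Const 0)) (Const 0)) (Seq PutWeights PutRadii))
              ((length xs * 3 + 3) + ((n * 4 + 2) + (4 * (4 * z + 5) + 9))) post s5"
            proof (rule wp_Seq, rule wp_conseq[OF wp_Copy[where k = 0] order_refl])
              fix s6 assume out6: "s6 ''out'' 0 = int (length xs) \<and>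
                  (\<forall>i<length xs. s6 ''out'' (1 + int i) = s5 ''in'' (1 + 0 + int i))"
                and "\<And>X. X \<notin> writes (Copy (Load ''in'' (Const 0)) (Const 0)) \<Longrightarrow> s6 X = s5 X"
              then have fr6: "s6 ''in'' = g" "s6 ''T'' = s4 ''T''" "s6 ''C'' = s5 ''C''" using fr5 by auto
              have copy: "s6 ''out'' i = g i" if "1 \<le> i" "i \<le> int (length xs)" for i
              proof -
                have "nat (i - 1) < length xs" "1 + int (nat (i - 1)) = i" using that by auto
                then show ?thesis using out6 fr5 by (metis add_0_right)
              qed
              show "wp M (Seq PutWeights PutRadii) ((n * 4 + 2) + (4 * (4 * z + 5) + 9)) post s6"
              proof (rule wp_Seq, rule wp_conseq[OF wp_PutWeights[where s = s6 and g = g and N = n, OF fr6(1) g_N] order_refl])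
                fix s7 assume out7: "\<forall>i. s7 ''out'' i = (let b = 2 + 2 * (int n * int n) in
                     if b \<le> i \<and> i < b + int n then s6 ''C'' (i - b)
                     else if b + int n \<le> i \<and> i < b + 2 * int n then s6 ''T'' (i - b - int n + 1)
                     else s6 ''out'' i)"
                  and "\<And>X. X \<notin> writes PutWeights \<Longrightarrow> s7 X = s6 X"
                then have fr7: "s7 ''in'' = g" using fr6 by simp
                show "wp M PutRadii (4 * (4 * z + 5) + 9) post s7"
                proof (rule wp_conseq[OF wp_PutRadii[where s = s7 and g = g and N = n and c = c and A = A and D = D, OF fr7 g_N c_eq g_nn A_eq D_eq AD_le prod] order_refl])
                  fix s8 assume out8: "s8 ''out'' = (s7 ''out'')(c + 4 := A div gcd A D,
                    c + 5 := D div gcd A D, c + 6 := 0, c + 7 := 1)"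
                  have bc: "2 \<le> b" "b \<le> c" "c + 7 = int (length xs)" by (auto simp: b_def c_def len)
                  have keep: "s7 ''out'' i = s6 ''out'' i" if "i < b \<or> c \<le> i" for i
                    using that out7 by (auto simp: Let_def c_def simp flip: b_def)
                  have low: "s8 ''out'' i = g i" if "1 \<le> i" "i < b" for i
                    using that copy[of i] keep[of i] bc by (auto simp: out8)
                  have mid: "s8 ''out'' i = g i" if "c \<le> i" "i < c + 4" for i
                    using that copy[of i] keep[of i] bc by (auto simp: out8)
                  have "stored (s8 ''out'') 1 (enc_instance (transformed I \<chi>r wb))"
                  proof (subst stored_enc_instance[OF _ b_def], goal_cases)
                    case 2
                    have "row_stored (s8 ''out'') (transformed I \<chi>r wb) n"
                    proof (rule row_stored_cong[of g I])
                      show "row_stored g I n" using lay by blast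
                      show "s8 ''out'' i = g i" if "2 \<le> i" "i < 2 + 2 * (int n * int n)" for i
                        using low[of i] that by (simp add: b_def)
                    qed simp
                    moreover have "s8 ''out'' (b + int x) = int (\<chi>r x)" if "x < n" for x
                      using that C[OF that] fr6 out7[rule_format, of "b + int x"] unfolding out8
                      by (simp add: Let_def c_def \<chi>r_def flip: b_def)
                    moreover have "s8 ''out'' (b + (int n + int x)) = int (wb x)" if "x < n" for x
                      using that wb[of x] fr6 out7[rule_format, of "b + (int n + int x)"] unfolding out8
                      by (simp add: Let_def c_def add.commute flip: b_def)
                    moreover have "s8 ''out'' 1 = int n" using low[of 1] bc g_N by simp
                    moreover have "stored (s8 ''out'') c [m_red I, m_blue I, int (k1 I), int (k2 I)]"
                      using lay mid by simp
                    moreover have "stored (s8 ''out'') (c + 4) (enc_rat (rad1 I + 26 * rad2 I))"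
                      unfolding rad by (simp add: out8)
                    moreover have "stored (s8 ''out'') (c + 6) (enc_rat 0)"
                      using enc_rat_divide[of 1 0] by (simp add: out8)
                    ultimately show ?case by (simp add: c_def)
                  qed (simp add: n_def)
                  moreover have "s8 ''out'' 0 = int (length (enc_instance (transformed I \<chi>r wb)))"
                    using out6 keep[of 0] bc len by (simp add: out8 length_enc_instance n_def)
                  ultimately show "post s8" using red out_list_stored unfolding post_def by blast
                qed
              qed (use nL W in auto)
            qed (use fr5 g0 W in auto)
          qed (use fr4 in auto)
        qed (use fr3 in auto)
      qed (use fr2 in auto)
    qed (use fr1 in auto)
  qed (use in0 zero in auto)
  moreover have "transform_steps n (length xs) z \<le> transform_steps z z z"
    using length_le_input_size[of xs] nL by (intro transform_steps_mono) (auto simp: z_def)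
  ultimately show ?thesis
    unfolding post_def Let_def M_def s0_def xs_def z_def by (rule wp_conseq) auto
qed

section \<open>Polynomial bounds and conclusion\<close>

text \<open>Closure under sums and products spares writing out the polynomial that bounds the
  running time.\<close>

definition polynomial_fun :: "(nat \<Rightarrow> nat) \<Rightarrow> bool" where
  "polynomial_fun f \<longleftrightarrow> (\<exists>P. \<forall>x. f x = poly P x)"

lemma polynomial_fun_intros:
  "polynomial_fun (\<lambda>x. x)"
  "polynomial_fun (\<lambda>x. c)"
  "\<lbrakk>polynomial_fun f; polynomial_fun h\<rbrakk> \<Longrightarrow> polynomial_fun (\<lambda>x. f x + h x)"
  "\<lbrakk>polynomial_fun f; polynomial_fun h\<rbrakk> \<Longrightarrow> polynomial_fun (\<lambda>x. f x * h x)"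
proof -
  show "polynomial_fun (\<lambda>x. x)" unfolding polynomial_fun_def by (intro exI[of _ "[:0, 1:]"]) simp
  show "polynomial_fun (\<lambda>x. c)" unfolding polynomial_fun_def by (intro exI[of _ "[:c:]"]) simp
  assume "polynomial_fun f" "polynomial_fun h"
  then obtain P R where "\<And>x. f x = poly P x" "\<And>x. h x = poly R x" unfolding polynomial_fun_def by blast
  then have "\<forall>x. f x + h x = poly (P + R) x" "\<forall>x. f x * h x = poly (P * R) x" by simp_all
  then show "polynomial_fun (\<lambda>x. f x + h x)" "polynomial_fun (\<lambda>x. f x * h x)"
    unfolding polynomial_fun_def by blast+
qed

lemma polytime_onI:
  assumes "polynomial_fun h"
    and "\<And>x. x \<in> D \<Longrightarrow> \<exists>t s. exec c (init_mem (enc x)) t s \<and> out_list s = f x \<and>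
      t + length (f x) \<le> h (input_size (enc x))"
  shows "polytime_on D enc f"
proof -
  obtain P where "\<And>x. h x = poly P x" using assms(1) unfolding polynomial_fun_def by blast
  then show ?thesis using assms(2) unfolding polytime_on_def by metis
qed

lemma length_enc_solution: "length (enc_solution n S) = 2 * n"
  by (simp add: enc_solution_def)

text \<open>The centres of an approximate solution are returned unchanged, so recovery only copies
  the last \<open>2 * n\<close> input entries; their offset is the total length minus
  \<open>2 * n\<close>. This works for every pair, whatever the domain.\<close>

lemma polytime_second_component:
  "polytime_on D (\<lambda>(I, S). enc_instance I @ enc_solution (card (pts I)) S)
     (\<lambda>(I, S). enc_solution (card (pts I)) S)"
proof (rule polytime_onI[where c = "Copy (Mul (Const 2) nE) (Sub (Load ''in'' (Const 0)) (Mul (Const 2) nE))"])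
  let ?c = "Copy (Mul (Const 2) nE) (Sub (Load ''in'' (Const 0)) (Mul (Const 2) nE))"
  let ?h = "\<lambda>z. (z * 3 + 3) * (csize ?c * (2 * z + 8)) + z"
  show "polynomial_fun ?h" by (intro polynomial_fun_intros)
  fix x :: "nat cnukc \<times> nat set \<times> nat set"
  obtain I S where x: "x = (I, S)" by (cases x)
  define n where "n = card (pts I)"
  define xs ys where "xs = enc_instance I" and "ys = enc_solution n S"
  have len: "length ys = 2 * n" by (simp add: ys_def length_enc_solution)
  have st: "stored (init_mem (xs @ ys) ''in'') 1 (xs @ ys)" and
    in0: "init_mem (xs @ ys) ''in'' 0 = int (length xs) + int (2 * n)"
    using stored_init_mem[of "xs @ ys"] len by auto
  have in1: "init_mem (xs @ ys) ''in'' 1 = int n"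
    using st unfolding xs_def by (simp add: enc_instance_def Let_def n_def)
  have M: "int (2 * n) \<le> value_bound (xs @ ys)"
    using length_le_power[of "xs @ ys"] power_le_value_bound[of "xs @ ys"] len by simp
  have "wp (value_bound (xs @ ys)) ?c (2 * n * 3 + 3)
    (\<lambda>s. s ''out'' 0 = int (2 * n) \<and>
      (\<forall>i<2 * n. s ''out'' (1 + int i) = init_mem (xs @ ys) ''in'' (1 + int (length xs) + int i))) (init_mem (xs @ ys))"
    by (rule wp_Copy) (use in0 in1 M in auto)
  from exec_wp[OF this] obtain t s where ex: "exec ?c (init_mem (xs @ ys)) t s"
      "t \<le> (2 * n * 3 + 3) * (csize ?c * (2 * input_size (xs @ ys) + 8))"
    and out: "s ''out'' 0 = int (2 * n)"
      "\<forall>i<2 * n. s ''out'' (1 + int i) = init_mem (xs @ ys) ''in'' (1 + int (length xs) + int i)" by blast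
  have "stored (init_mem (xs @ ys) ''in'') (1 + int (length xs)) ys"
    using st by (simp add: stored_append)
  then have "stored (s ''out'') 1 ys" using out(2) len by (simp add: stored_def)
  then have "out_list s = ys"
    using out(1) len by (intro out_list_stored) auto
  moreover have "2 * n \<le> input_size (xs @ ys)"
    using length_le_input_size[of "xs @ ys"] len by simp
  then have "(2 * n * 3 + 3) * (csize ?c * (2 * input_size (xs @ ys) + 8)) + length ys \<le> ?h (input_size (xs @ ys))"
    using len by (intro add_mono mult_right_mono) auto
  then have "t + length ys \<le> ?h (input_size (xs @ ys))" using ex(2) by linarith
  ultimately show "\<exists>t s. exec ?c (init_mem (case x of (I, S) \<Rightarrow> enc_instance I @ enc_solution (card (pts I)) S)) t s \<and>
      out_list s = (case x of (I, S) \<Rightarrow> enc_solution (card (pts I)) S) \<and>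
      t + length (case x of (I, S) \<Rightarrow> enc_solution (card (pts I)) S)
        \<le> ?h (input_size (case x of (I, S) \<Rightarrow> enc_instance I @ enc_solution (card (pts I)) S))"
    using ex(1) unfolding x xs_def ys_def n_def by auto
qed

lemma length_enc_transformed: "length (enc_instance (transformed I \<chi>r \<chi>b)) = length (enc_instance I)"
  by (simp add: length_enc_instance)

theorem theorem3:
  shows "\<exists>(c :: real) (T :: nat cnukc \<Rightarrow> nat cnukc)
            (R :: nat cnukc \<Rightarrow> nat set \<times> nat set \<Rightarrow> nat set \<times> nat set).
    c > 0 \<and>
    polytime_on {I. cnukc_instance I \<and> encodable I} enc_instance (\<lambda>I. enc_instance (T I)) \<and>
    polytime_on
      {(I, S). cnukc_instance I \<and> encodable I \<and> (\<exists>\<alpha>\<ge>1. approx_solution \<alpha> (T I) S)}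
      (\<lambda>(I, S). enc_instance I @ enc_solution (card (pts I)) S)
      (\<lambda>(I, S). enc_solution (card (pts I)) (R I S)) \<and>
    (\<forall>I. cnukc_instance I \<and> encodable I \<longrightarrow>
      (\<exists>\<chi>r \<chi>b. T I = I\<lparr>red := \<chi>r, blue := \<chi>b, rad1 := rad1 I + 26 * rad2 I, rad2 := 0\<rparr>) \<and>
      ((\<exists>S. feasible_solution I S) \<longrightarrow> (\<exists>S. feasible_solution (T I) S)) \<and>
      (\<forall>\<alpha>\<ge>1. \<forall>S. approx_solution \<alpha> (T I) S \<longrightarrow> approx_solution (c * \<alpha>) I (R I S)))"
proof -
  define D where "D = {I :: nat cnukc. cnukc_instance I \<and> encodable I}"
  \<comment> \<open>Both facts are stated about one \<open>J\<close>, so that the instance picked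
    for \<open>T I\<close> is the one the program really prints.\<close>
  have "\<exists>J. (\<exists>\<chi>r \<chi>b. reduction I \<chi>r \<chi>b \<and> J = transformed I \<chi>r \<chi>b) \<and>
      (\<exists>t s. exec Transform (init_mem (enc_instance I)) t s \<and> out_list s = enc_instance J \<and>
        t \<le> transform_steps (input_size (enc_instance I)) (input_size (enc_instance I)) (input_size (enc_instance I)) *
          (csize Transform * (2 * input_size (enc_instance I) + 8)))" if "I \<in> D" for I
    using exec_wp[OF wp_Transform] that unfolding D_def Let_def by blast
  then obtain T where T: "\<And>I. I \<in> D \<Longrightarrow> \<exists>\<chi>r \<chi>b. reduction I \<chi>r \<chi>b \<and> T I = transformed I \<chi>r \<chi>b"
    "\<And>I. I \<in> D \<Longrightarrow> \<exists>t s. exec Transform (init_mem (enc_instance I)) t s \<and> out_list s = enc_instance (T I) \<and>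
        t \<le> transform_steps (input_size (enc_instance I)) (input_size (enc_instance I)) (input_size (enc_instance I)) *
          (csize Transform * (2 * input_size (enc_instance I) + 8))"
    by metis
  have "polytime_on D enc_instance (\<lambda>I. enc_instance (T I))"
  proof (rule polytime_onI)
    show "polynomial_fun (\<lambda>z. transform_steps z z z * (csize Transform * (2 * z + 8)) + z)"
      unfolding transform_steps_def greedy_steps_def favourite_steps_def by (intro polynomial_fun_intros)
    fix I assume I: "I \<in> D"
    have "length (enc_instance (T I)) \<le> input_size (enc_instance I)"
      using T(1)[OF I] length_enc_transformed length_le_input_size by metis
    then show "\<exists>t s. exec Transform (init_mem (enc_instance I)) t s \<and> out_list s = enc_instance (T I) \<and>
        t + length (enc_instance (T I)) \<le> transform_steps (input_size (enc_instance I)) (input_size (enc_instance I)) (input_size (enc_instance I)) *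
          (csize Transform * (2 * input_size (enc_instance I) + 8)) + input_size (enc_instance I)"
      using T(2)[OF I] add_mono by blast
  qed
  moreover have "(\<exists>\<chi>r \<chi>b. T I = transformed I \<chi>r \<chi>b) \<and>
      ((\<exists>S. feasible_solution I S) \<longrightarrow> (\<exists>S. feasible_solution (T I) S)) \<and>
      (\<forall>\<alpha>\<ge>1. \<forall>S. approx_solution \<alpha> (T I) S \<longrightarrow> approx_solution (53 * \<alpha>) I S)" if "I \<in> D" for I
  proof -
    from T(1)[OF that] obtain \<chi>r \<chi>b where *: "reduction I \<chi>r \<chi>b" "T I = transformed I \<chi>r \<chi>b"
      by blast
    have "cnukc_instance I" using that by (simp add: D_def)
    then show ?thesis using reduction_feasible[OF _ *(1)] reduction_approx[OF _ *(1)] unfolding *(2) by blast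
  qed
  ultimately show ?thesis
    using polytime_second_component
    by (intro exI[of _ 53] exI[of _ T] exI[of _ "\<lambda>I S. S"]) (auto simp: D_def)
qed

end
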